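(* Let $\epsilon,\delta\in(0,1)$, $c>0$, and let $m=O(\log(1/\delta)/\epsilon^2)$ (i.e. $m\ge C\log(1/\delta)/\epsilon^2$ for a suitable absolute constant $C$). There exist a randomized sketching procedure $\mathcal S$ producing size-$m$ sketches (based on unweighted MinHash sketches) and an estimation procedure $\mathcal F$ such that for any $\mathbf a,\mathbf b\in\mathbb R^n$ with all entries in $[-c,c]$, with probability at least $1-\delta$, $$\left|\mathcal F(\mathcal S(\mathbf a),\mathcal S(\mathbf b))-\langle\mathbf a,\mathbf b\rangle\right|\le \epsilon\cdot c^2\cdot\sqrt{\max(|\mathcal A|,|\mathcal B|)\cdot|\mathcal A\cap\mathcal B|},$$ where $\mathcal A=\{i:\mathbf a[i]\neq0\}$ and $\mathcal B=\{i:\mathbf b[i]\neq 0\}$.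
   Context: $\langle \mathbf a,\mathbf b\rangle=\sum_{k=1}^n\mathbf a[k]\mathbf b[k]$. Sketches are computed from each vector separately using randomness independent of the inputs and shared across vectors; probability is over this randomness. Fully random hash functions $h:\{1,\dots,n\}\to[0,1]$ (independent uniform values) are assumed available. The unweighted MinHash sketch of $\mathbf a$ with $m$ samples is: for $i=1,\dots,m$, draw an independent fully random hash function $h^i$ (the same $h^i$ for all sketched vectors), let $j^*=\arg\min_{j:\mathbf a[j]\neq0}h^i(j)$, and store $H^{hash}_{\mathbf a}[i]=h^i(j^* )$ and $H^{val}_{\mathbf a}[i]=\mathbf a[j^*]$. *)

theory Defs
  imports "HOL-Probability.Probability"
begin

definition supp :: "nat \<Rightarrow> (nat \<Rightarrow> real) \<Rightarrow> nat set" where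
  "supp n a = {j \<in> {..<n}. a j \<noteq> 0}"

definition inner_prod :: "nat \<Rightarrow> (nat \<Rightarrow> real) \<Rightarrow> (nat \<Rightarrow> real) \<Rightarrow> real" where
  "inner_prod n a b = (\<Sum>k<n. a k * b k)"

text \<open>Randomness: m*n independent uniform [0,1] values; hash function i is
  \<open>\<lambda>j. \<omega> (i, j)\<close> for i < m, j < n.\<close>
definition hash_space :: "nat \<Rightarrow> nat \<Rightarrow> (nat \<times> nat \<Rightarrow> real) measure" where
  "hash_space m n = PiM ({..<m} \<times> {..<n}) (\<lambda>_. uniform_measure lborel {0..1})"

text \<open>Unweighted MinHash sketch with m samples: entry i is the pair
  (H_hash[i], H_val[i]) = (h^i(j*), a[j*]) with j* the argmin of h^i over the support.
  (Ties occur with probability zero; the argmin is then an arbitrary minimiser.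
  For the zero vector, where the argmin is undefined, we store the sentinel (1, 0).)\<close>
definition minhash_sketch ::
  "nat \<Rightarrow> nat \<Rightarrow> (nat \<times> nat \<Rightarrow> real) \<Rightarrow> (nat \<Rightarrow> real) \<Rightarrow> (real \<times> real) list" where
  "minhash_sketch m n \<omega> a =
     map (\<lambda>i. if supp n a = {} then (1, 0)
               else (let j = arg_min_on (\<lambda>j. \<omega> (i, j)) (supp n a)
                     in (\<omega> (i, j), a j))) [0..<m]"

end

theory Submission
  imports Defs
begin

text \<open>
  Put \<open>U = A \<union> B\<close>, \<open>V = A \<inter> B\<close>, \<open>N = |U|\<close>, \<open>J = |V| / N\<close>, \<open>p\<^sub>j = a\<^sub>j b\<^sub>j / c\<^sup>2\<close> and \<open>s = \<Sum>\<^sub>V p\<^sub>j\<close>.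
  Let \<open>X\<close> be \<open>p\<^sub>j\<close> if the two sketch entries agree, at \<open>j\<close>, and \<open>0\<close> otherwise; let \<open>Q\<close> be the
  indicator of agreement, and \<open>Y = - ln (1 - h)\<close> with \<open>h\<close> the smaller of the two stored hashes.
  Then \<open>E X = s / N\<close>, \<open>E Q = J\<close>, and \<open>Y\<close> is exponential with rate \<open>N\<close>. Hence \<open>X - s Y\<close> is
  centred with second moment at most \<open>6 J\<close>, and by Chebyshev the ratio \<open>\<Sum>X / \<Sum>Y\<close> over
  \<open>O(1 / \<epsilon>\<^sup>2)\<close> samples is within \<open>\<epsilon> N sqrt (J / 2)\<close> of \<open>s\<close> with probability \<open>3 / 4\<close>. The median
  over \<open>O(ln (1 / \<delta>))\<close> groups boosts this to \<open>1 - \<delta>\<close>; finally \<open>N \<le> 2 max |A| |B|\<close>.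

  If \<open>\<delta>\<close> is so close to \<open>1\<close> that \<open>m\<close> does not even fill one group, only a success probability
  of order \<open>m \<epsilon>\<^sup>2\<close> is required. It is obtained by adding to the ratio a random offset on the
  scale of the standard deviation (estimated from \<open>\<Sum>Q\<close>), extracted from the hash of sample \<open>0\<close>,
  and by returning \<open>0\<close> with constant probability, which covers \<open>J \<le> \<epsilon>\<^sup>2 / 2\<close>.
\<close>

section \<open>Deviation and amplification\<close>

text \<open>The cross terms vanish because each new summand is centred and independent of the sum of
  the earlier ones. Integrability of the squared sum is carried along in the same induction.\<close>

lemma (in prob_space) indep_sum_second_moment:
  fixes Z :: "'i \<Rightarrow> 'a \<Rightarrow> real"
  assumes "finite K" and "indep_vars (\<lambda>_. borel) Z K"
    and "\<And>i. i \<in> K \<Longrightarrow> integrable M (\<lambda>\<omega>. (Z i \<omega>)\<^sup>2)"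
    and "\<And>i. i \<in> K \<Longrightarrow> expectation (Z i) = 0"
  shows "integrable M (\<lambda>\<omega>. (\<Sum>i\<in>K. Z i \<omega>)\<^sup>2) \<and>
    expectation (\<lambda>\<omega>. (\<Sum>i\<in>K. Z i \<omega>)\<^sup>2) = (\<Sum>i\<in>K. expectation (\<lambda>\<omega>. (Z i \<omega>)\<^sup>2))"
  using assms
proof (induction K rule: finite_induct)
  case empty
  show ?case by simp
next
  case (insert j K)
  have rv: "i \<in> insert j K \<Longrightarrow> Z i \<in> borel_measurable M" for i
    using insert.prems(1) by (auto simp: indep_vars_def)
  have int: "i \<in> insert j K \<Longrightarrow> integrable M (Z i)" for i
    by (rule square_integrable_imp_integrable) (use rv insert.prems in auto)
  have IH: "integrable M (\<lambda>\<omega>. (\<Sum>i\<in>K. Z i \<omega>)\<^sup>2)"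
    "expectation (\<lambda>\<omega>. (\<Sum>i\<in>K. Z i \<omega>)\<^sup>2) = (\<Sum>i\<in>K. expectation (\<lambda>\<omega>. (Z i \<omega>)\<^sup>2))"
    using insert.IH[OF indep_vars_subset[OF insert.prems(1)]] insert.prems by auto
  have ind: "indep_var borel (Z j) borel (\<lambda>\<omega>. \<Sum>i\<in>K. Z i \<omega>)"
    by (rule indep_vars_sum) (use insert in auto)
  have intS: "integrable M (\<lambda>\<omega>. \<Sum>i\<in>K. Z i \<omega>)"
    using int by auto
  have cross: "integrable M (\<lambda>\<omega>. Z j \<omega> * (\<Sum>i\<in>K. Z i \<omega>))"
    "expectation (\<lambda>\<omega>. Z j \<omega> * (\<Sum>i\<in>K. Z i \<omega>)) = 0"
    using indep_var_integrable[OF ind] indep_var_lebesgue_integral[OF ind] int intS insert.prems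
    by auto
  have eq: "(\<Sum>i\<in>insert j K. Z i \<omega>)\<^sup>2
      = (Z j \<omega>)\<^sup>2 + 2 * (Z j \<omega> * (\<Sum>i\<in>K. Z i \<omega>)) + (\<Sum>i\<in>K. Z i \<omega>)\<^sup>2" for \<omega>
    using insert.hyps by (simp add: power2_eq_square algebra_simps)
  have j: "integrable M (\<lambda>\<omega>. (Z j \<omega>)\<^sup>2)"
    using insert.prems by simp
  show ?case
    unfolding eq using j cross IH insert.hyps
    by simp
qed

text \<open>Markov's inequality for the squared sum. The failure event is the strict one, so that
  the bound survives \<open>v = 0\<close>, which occurs later for disjoint supports, where
  \<open>J = 0\<close>.\<close>

lemma (in prob_space) indep_sum_deviation:
  fixes Z :: "'i \<Rightarrow> 'a \<Rightarrow> real"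
  assumes K: "finite K" "indep_vars (\<lambda>_. borel) Z K"
    and sq: "\<And>i. i \<in> K \<Longrightarrow> integrable M (\<lambda>\<omega>. (Z i \<omega>)\<^sup>2)"
    and mean: "\<And>i. i \<in> K \<Longrightarrow> expectation (Z i) = 0"
    and v: "\<And>i. i \<in> K \<Longrightarrow> expectation (\<lambda>\<omega>. (Z i \<omega>)\<^sup>2) \<le> v"
    and c: "c > 0"
  shows "prob {\<omega> \<in> space M. \<not> (\<Sum>i\<in>K. Z i \<omega>)\<^sup>2 \<le> c * (real (card K) * v)} \<le> 1 / c"
proof -
  have rv[measurable]: "i \<in> K \<Longrightarrow> Z i \<in> borel_measurable M" for i
    using K by (auto simp: indep_vars_def)
  let ?S = "\<lambda>\<omega>. (\<Sum>i\<in>K. Z i \<omega>)\<^sup>2"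
  have m[measurable]: "?S \<in> borel_measurable M" by measurable
  have int: "integrable M ?S" and ex: "expectation ?S \<le> real (card K) * v"
    using indep_sum_second_moment[OF K sq mean] sum_bounded_above[of K _ v, OF v] by auto
  have nn: "0 \<le> expectation ?S" by (rule integral_nonneg_AE) auto
  show ?thesis
  \<comment> \<open>At level zero Markov's inequality would divide by zero; there the squared sum
    has mean zero and hence vanishes almost surely.\<close>
  proof (cases "real (card K) * v = 0")
    case True
    then have "expectation ?S = 0" using ex nn by linarith
    then have "AE \<omega> in M. ?S \<omega> = 0"
      using integral_nonneg_eq_0_iff_AE[OF int] by auto
    then have "AE \<omega> in M. \<not> (\<not> ?S \<omega> \<le> c * (real (card K) * v))"
      unfolding True by eventually_elim simp
    then have "prob {\<omega> \<in> space M. \<not> ?S \<omega> \<le> c * (real (card K) * v)} = 0"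
      by (subst prob_eq_0) auto
    then show ?thesis using c by simp
  next
    case False
    then have pos: "real (card K) * v > 0" using ex nn by linarith
    have "prob {\<omega> \<in> space M. \<not> ?S \<omega> \<le> c * (real (card K) * v)}
        \<le> prob {\<omega> \<in> space M. ?S \<omega> \<ge> c * (real (card K) * v)}"
      by (rule finite_measure_mono) auto
    also have "\<dots> \<le> expectation ?S / (c * (real (card K) * v))"
      by (rule integral_Markov_inequality_measure[OF int, of "{}", simplified]) (use pos c in auto)
    also have "\<dots> \<le> real (card K) * v / (c * (real (card K) * v))"
      using ex pos c by (intro divide_right_mono) auto
    also have "\<dots> = 1 / c" using False by (simp add: field_simps)
    finally show ?thesis .
  qed
qed

lemma exponential_second_moment:
  assumes "prob_space M" "0 < l" "distributed M lborel X (exponential_density l)"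
  shows "integrable M (\<lambda>\<omega>. (X \<omega>)\<^sup>2)" "integral\<^sup>L M (\<lambda>\<omega>. (X \<omega>)\<^sup>2) = 2 / l\<^sup>2"
proof -
  interpret prob_space M by fact
  show "integrable M (\<lambda>\<omega>. (X \<omega>)\<^sup>2)"
    using erlang_ith_moment_integrable[of l X 0 2] assms by simp
  show "integral\<^sup>L M (\<lambda>\<omega>. (X \<omega>)\<^sup>2) = 2 / l\<^sup>2"
    using erlang_ith_moment[of l X 0 2] assms by (simp add: fact_numeral)
qed

section \<open>Medians and majorities\<close>

text \<open>The lower median of the first \<open>g\<close> entries, expressed by counting rather
  than by sorting.\<close>

definition med :: "nat \<Rightarrow> (nat \<Rightarrow> real) \<Rightarrow> real" where
  "med g x = Min (x ` {i. i < g \<and> g \<le> 2 * card {j. j < g \<and> x j \<le> x i}})"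

text \<open>More than half of the entries are good, so the largest good entry is a candidate for the
  minimum and bounds the median from above. A candidate below \<open>lo\<close> would have half of
  the entries at or below it, all of them bad.\<close>

lemma med_between:
  assumes "2 * card {j. j < g \<and> \<not> (lo \<le> x j \<and> x j \<le> hi)} < g"
  shows "lo \<le> med g x" "med g x \<le> hi"
proof -
  let ?bad = "{j. j < g \<and> \<not> (lo \<le> x j \<and> x j \<le> hi)}"
  let ?good = "{j. j < g \<and> lo \<le> x j \<and> x j \<le> hi}"
  let ?I = "{i. i < g \<and> g \<le> 2 * card {j. j < g \<and> x j \<le> x i}}"
  have "card (?bad \<union> ?good) = card ?bad + card ?good"
    by (rule card_Un_disjoint) auto
  moreover have "?bad \<union> ?good = {..<g}" by auto
  ultimately have cg: "g < 2 * card ?good" using assms by simp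
  then have ne: "?good \<noteq> {}" by (intro notI) simp
  have "\<exists>i\<in>?good. \<forall>j\<in>?good. x j \<le> x i"
  proof -
    have "Max (x ` ?good) \<in> x ` ?good" using ne by (intro Max_in) auto
    then obtain i where i: "i \<in> ?good" "Max (x ` ?good) = x i" by (rule imageE)
    have "x j \<le> x i" if "j \<in> ?good" for j
      unfolding i(2)[symmetric] using that by (intro Max_ge finite_imageI imageI) auto
    then show ?thesis using i(1) by blast
  qed
  then obtain i where i: "i \<in> ?good" "\<And>j. j \<in> ?good \<Longrightarrow> x j \<le> x i" by blast
  have "card ?good \<le> card {j. j < g \<and> x j \<le> x i}"
    using i by (intro card_mono) auto
  then have iI: "i \<in> ?I" using i cg by auto
  then have "med g x \<le> x i" unfolding med_def by (intro Min_le) auto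
  then show "med g x \<le> hi" using i by auto
  show "lo \<le> med g x"
    unfolding med_def
  proof (rule Min.boundedI)
    show "finite (x ` ?I)" by simp
    show "x ` ?I \<noteq> {}" using iI by blast
    fix z assume "z \<in> x ` ?I"
    then obtain l where l: "l \<in> ?I" "z = x l" by auto
    show "lo \<le> z"
    proof (rule ccontr)
      assume "\<not> lo \<le> z"
      then have "card {j. j < g \<and> x j \<le> x l} \<le> card ?bad"
        using l by (intro card_mono) auto
      with l assms show False by simp
    qed
  qed
qed

text \<open>Hoeffding's inequality: the mean number of bad groups is at most \<open>g / 4\<close>,
  and failure means exceeding this by \<open>g / 4\<close>, so the exponent is 2 (g/4)^2 / g =
  g/8.\<close>

lemma (in prob_space) majority:
  assumes indep: "indep_vars (\<lambda>_. borel) (\<lambda>l \<omega>. of_bool (B l \<omega>) :: real) {..<g}"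
    and B: "\<And>l. l < g \<Longrightarrow> prob {\<omega> \<in> space M. B l \<omega>} \<le> 1 / 4" and g: "0 < g"
  shows "{\<omega> \<in> space M. 2 * card {l. l < g \<and> B l \<omega>} < g} \<in> events \<and>
    prob {\<omega> \<in> space M. 2 * card {l. l < g \<and> B l \<omega>} < g} \<ge> 1 - exp (- real g / 8)"
proof -
  let ?b = "\<lambda>l \<omega>. of_bool (B l \<omega>) :: real"
  have rv[measurable]: "l < g \<Longrightarrow> ?b l \<in> borel_measurable M" for l
    using indep by (auto simp: indep_vars_def)
  interpret H: Hoeffding_ineq M "{..<g}" ?b "\<lambda>_. 0" "\<lambda>_. 1" "\<Sum>l<g. expectation (?b l)"
    by unfold_locales (use indep in auto)
  have mean: "(\<Sum>l<g. expectation (?b l)) \<le> real g / 4"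
  proof -
    have "expectation (?b l) \<le> 1 / 4" if "l < g" for l
    proof -
      have "expectation (?b l) = expectation (indicator {\<omega> \<in> space M. B l \<omega>})"
        by (rule Bochner_Integration.integral_cong) (auto simp: indicator_def)
      also have "\<dots> = prob {\<omega> \<in> space M. B l \<omega>}"
        by simp (rule arg_cong[where f = prob], auto)
      finally show ?thesis using B[OF that] by simp
    qed
    then show ?thesis using sum_bounded_above[of "{..<g}" "\<lambda>l. expectation (?b l)" "1/4"] by simp
  qed
  have card_eq: "real (card {l. l < g \<and> B l \<omega>}) = (\<Sum>l<g. ?b l \<omega>)" for \<omega>
  proof -
    have "(\<Sum>l<g. ?b l \<omega>) = (\<Sum>l\<in>{l. l < g \<and> B l \<omega>}. 1)"
      by (rule sum.mono_neutral_cong_right) auto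
    then show ?thesis by simp
  qed
  have iff: "2 * card {l. l < g \<and> B l \<omega>} < g \<longleftrightarrow> \<not> (\<Sum>l<g. ?b l \<omega>) \<ge> real g / 2" for \<omega>
    unfolding card_eq[symmetric] by linarith
  let ?F = "{\<omega> \<in> space M. (\<Sum>l<g. ?b l \<omega>) \<ge> real g / 2}"
  have F: "?F \<in> events" by measurable
  have "prob ?F \<le> prob {\<omega> \<in> space M. (\<Sum>l<g. ?b l \<omega>) \<ge> (\<Sum>l<g. expectation (?b l)) + real g / 4}"
  proof (rule finite_measure_mono)
    show "?F \<subseteq> {\<omega> \<in> space M. (\<Sum>l<g. ?b l \<omega>) \<ge> (\<Sum>l<g. expectation (?b l)) + real g / 4}"
    proof (intro subsetI CollectI conjI)
      fix \<omega> assume "\<omega> \<in> ?F"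
      then have "\<omega> \<in> space M" "real g / 2 \<le> (\<Sum>l<g. ?b l \<omega>)" by blast+
      then show "\<omega> \<in> space M" "(\<Sum>l<g. expectation (?b l)) + real g / 4 \<le> (\<Sum>l<g. ?b l \<omega>)"
        using mean by linarith+
    qed
  qed measurable
  also have "\<dots> \<le> exp (- 2 * (real g / 4)\<^sup>2 / (\<Sum>l<g. (1 - 0)\<^sup>2))"
    by (rule H.Hoeffding_ineq_ge) (use g in auto)
  also have "\<dots> = exp (- real g / 8)"
    using g by (simp add: power2_eq_square)
  finally have le: "prob ?F \<le> exp (- real g / 8)" .
  have eq: "{\<omega> \<in> space M. 2 * card {l. l < g \<and> B l \<omega>} < g} = space M - ?F"
    unfolding iff by blast
  show ?thesis
    unfolding eq prob_compl[OF F] using F le by (intro conjI sets.compl_sets) linarith+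
qed

text \<open>Conditioning on \<open>Z\<close>, as Fubini's theorem for the product of the two laws: a
  bound for every frozen value \<open>z\<close> in \<open>G\<close> integrates to a bound for the
  joint event. It serves both for hitting a random target and for excluding ties between two hash
  values.\<close>

lemma (in prob_space) prob_indep_fiberwise_ge:
  assumes ind: "indep_var borel Y borel Z"
    and R: "{x \<in> space (borel \<Otimes>\<^sub>M borel). R (fst x) (snd x)} \<in> sets (borel \<Otimes>\<^sub>M borel)"
    and G: "G \<in> sets borel"
    and ge: "\<And>z. z \<in> G \<Longrightarrow> prob {\<omega> \<in> space M. R (Y \<omega>) z} \<ge> p"
  shows "prob {\<omega> \<in> space M. Z \<omega> \<in> G \<and> R (Y \<omega>) (Z \<omega>)} \<ge> p * prob {\<omega> \<in> space M. Z \<omega> \<in> G}"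
proof -
  have [measurable]: "Y \<in> borel_measurable M" "Z \<in> borel_measurable M"
    using indep_var_rv1[OF ind] indep_var_rv2[OF ind] by auto
  note [measurable] = G
  have [measurable]: "Measurable.pred (borel \<Otimes>\<^sub>M borel) (\<lambda>x. R (fst x) (snd x))"
    using R by (simp add: pred_def)
  interpret Y: prob_space "distr M borel Y" by (rule prob_space_distr) simp
  interpret Z: prob_space "distr M borel Z" by (rule prob_space_distr) simp
  interpret YZ: pair_prob_space "distr M borel Y" "distr M borel Z" ..
  let ?W = "{x \<in> space (borel \<Otimes>\<^sub>M borel). snd x \<in> G \<and> R (fst x) (snd x)}"
  have W: "?W \<in> sets (borel \<Otimes>\<^sub>M borel)" by measurable
  have RY[measurable]: "{y. R y z} \<in> sets borel" for z
    using measurable_sets[of "\<lambda>y. (y, z)" borel "borel \<Otimes>\<^sub>M borel", OF _ R]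
    by (simp add: space_pair_measure vimage_def)
  have fib: "emeasure (distr M borel Y) ((\<lambda>y. (y, z)) -` ?W) \<ge> ennreal p * indicator G z" for z
  proof (cases "z \<in> G")
    case True
    have "(\<lambda>y. (y, z)) -` ?W = {y. R y z}"
      using True by (auto simp: space_pair_measure)
    then have "emeasure (distr M borel Y) ((\<lambda>y. (y, z)) -` ?W) = emeasure M {\<omega> \<in> space M. R (Y \<omega>) z}"
      by (simp add: emeasure_distr) (rule arg_cong2[where f = emeasure], auto)
    then show ?thesis using ge[OF True] True by (simp add: emeasure_eq_measure ennreal_leI)
  qed simp
  have "ennreal p * emeasure (distr M borel Z) G = (\<integral>\<^sup>+z. ennreal p * indicator G z \<partial>distr M borel Z)"
    using G by (simp add: nn_integral_cmult_indicator)
  also have "\<dots> \<le> (\<integral>\<^sup>+z. emeasure (distr M borel Y) ((\<lambda>y. (y, z)) -` ?W) \<partial>distr M borel Z)"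
    by (rule nn_integral_mono) (rule fib)
  also have "\<dots> = emeasure (distr M borel Y \<Otimes>\<^sub>M distr M borel Z) ?W"
    using W by (intro YZ.emeasure_pair_measure_alt2[symmetric]) simp
  also have "\<dots> = emeasure (distr M (borel \<Otimes>\<^sub>M borel) (\<lambda>x. (Y x, Z x))) ?W"
    using ind unfolding indep_var_distribution_eq by simp
  also have "\<dots> = emeasure M {\<omega> \<in> space M. Z \<omega> \<in> G \<and> R (Y \<omega>) (Z \<omega>)}"
    using W by (subst emeasure_distr) (auto intro!: arg_cong2[where f = emeasure] simp: space_pair_measure)
  finally have main: "ennreal p * emeasure (distr M borel Z) G
    \<le> emeasure M {\<omega> \<in> space M. Z \<omega> \<in> G \<and> R (Y \<omega>) (Z \<omega>)}" .
  have "emeasure (distr M borel Z) G = emeasure M {\<omega> \<in> space M. Z \<omega> \<in> G}"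
    by (subst emeasure_distr) (auto intro!: arg_cong2[where f = emeasure])
  with main have main': "ennreal p * ennreal (prob {\<omega> \<in> space M. Z \<omega> \<in> G})
    \<le> ennreal (prob {\<omega> \<in> space M. Z \<omega> \<in> G \<and> R (Y \<omega>) (Z \<omega>)})"
    by (simp add: emeasure_eq_measure)
  \<comment> \<open>\<open>ennreal\<close> truncates a negative \<open>p\<close> to zero, so that
    case is settled separately.\<close>
  show ?thesis
  proof (cases "0 \<le> p")
    case True
    with main' show ?thesis by (simp add: ennreal_mult[symmetric])
  next
    case False
    then have "p * prob {\<omega> \<in> space M. Z \<omega> \<in> G} \<le> 0" by (intro mult_nonpos_nonneg) auto
    then show ?thesis by (rule order_trans) simp
  qed
qed

section \<open>Rounding to powers of four, and masses of exponential intervals\<close>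

text \<open>For positive \<open>y\<close>, the largest integral power of 4 not exceeding
  \<open>y\<close>. The ratio 4 leaves room in each class [L, 4L) for a range [L, 2L) swept by the
  random offset and a range [2L, 4L) on which the estimator returns 0.\<close>

definition scale4 :: "real \<Rightarrow> real" where
  "scale4 y = 4 powr real_of_int \<lfloor>log 4 y\<rfloor>"

lemma scale4_eq:
  assumes "x > 0" "scale4 x \<le> y" "y < 4 * scale4 x"
  shows "scale4 y = scale4 x"
proof -
  let ?q = "\<lfloor>log 4 x\<rfloor>"
  have p: "scale4 x > 0" by (simp add: scale4_def)
  have "real_of_int ?q \<le> log 4 y"
    using assms p by (subst le_log_iff) (auto simp: scale4_def)
  moreover have "log 4 y < real_of_int ?q + 1"
    using assms p by (subst log_less_iff) (auto simp: scale4_def powr_add)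
  ultimately have "\<lfloor>log 4 y\<rfloor> = ?q" by linarith
  then show ?thesis by (simp add: scale4_def)
qed

lemma scale4_bounds:
  assumes "x > 0"
  shows "scale4 x \<le> x" "x < 4 * scale4 x"
proof -
  show "scale4 x \<le> x"
    using assms by (subst scale4_def, subst le_log_iff[symmetric]) auto
  have "x < 4 powr (real_of_int \<lfloor>log 4 x\<rfloor> + 1)"
    using assms by (subst log_less_iff[symmetric]) auto
  then show "x < 4 * scale4 x" by (simp add: scale4_def powr_add)
qed

lemma scale4_measurable [measurable]: "scale4 \<in> borel_measurable borel"
  unfolding scale4_def by measurable

text \<open>The exponential density decreases, so the mass of an interval is at least its length
  times the density at its right end; concretely this is \<open>1 + t \<le> exp t\<close> for
  \<open>t = l * r\<close>.\<close>

lemma (in prob_space) exponential_interval_ge: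
  assumes D: "distributed M lborel X (exponential_density l)" and "0 < l" "0 \<le> x" "0 \<le> r"
  shows "l * r * exp (- (x + r) * l) \<le> prob {\<omega> \<in> space M. x < X \<omega> \<and> X \<omega> \<le> x + r}"
proof -
  have [measurable]: "X \<in> borel_measurable M" using distributed_measurable[OF D] by simp
  have "{\<omega> \<in> space M. x < X \<omega> \<and> X \<omega> \<le> x + r} = {\<omega> \<in> space M. X \<omega> \<le> x + r} - {\<omega> \<in> space M. X \<omega> \<le> x}"
    by auto
  moreover have "prob ({\<omega> \<in> space M. X \<omega> \<le> x + r} - {\<omega> \<in> space M. X \<omega> \<le> x})
      = prob {\<omega> \<in> space M. X \<omega> \<le> x + r} - prob {\<omega> \<in> space M. X \<omega> \<le> x}"
    using \<open>0 \<le> r\<close> by (intro finite_measure_Diff) auto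
  ultimately have "prob {\<omega> \<in> space M. x < X \<omega> \<and> X \<omega> \<le> x + r}
      = prob {\<omega> \<in> space M. X \<omega> \<le> x + r} - prob {\<omega> \<in> space M. X \<omega> \<le> x}"
    by (rule trans[OF arg_cong[where f = prob]])
  also have "\<dots> = exp (- x * l) - exp (- (x + r) * l)"
    using exponential_distributedD_le[OF D, of "x + r"] exponential_distributedD_le[OF D, of x] assms by simp
  also have "exp (- x * l) = exp (- (x + r) * l) * exp (l * r)"
    unfolding mult_exp_exp by (rule arg_cong[where f = exp]) (simp add: algebra_simps)
  also have "exp (- (x + r) * l) * exp (l * r) - exp (- (x + r) * l) = exp (- (x + r) * l) * (exp (l * r) - 1)"
    by (simp only: right_diff_distrib mult_1_right)
  also have "\<dots> \<ge> exp (- (x + r) * l) * (l * r)"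
    using exp_ge_add_one_self[of "l * r"] by (intro mult_left_mono) (linarith, simp)
  finally show ?thesis by (simp only: mult.commute)
qed

section \<open>Abstract samples and the concentration of ratio estimators\<close>

text \<open>The triples are independent across samples, while the three coordinates of one triple
  may depend on each other; the moment bounds below use only their separate moments.\<close>

locale exp_samples = prob_space +
  fixes m :: nat and X Q Y :: "nat \<Rightarrow> 'a \<Rightarrow> real" and N J s :: real
  assumes indep: "indep_vars (\<lambda>_. borel \<Otimes>\<^sub>M borel \<Otimes>\<^sub>M borel) (\<lambda>i \<omega>. (X i \<omega>, Q i \<omega>, Y i \<omega>)) {..<m}"
    and N_ge: "N > 0"
    and Y_exp: "i < m \<Longrightarrow> distributed M lborel (Y i) (exponential_density N)"
    and X_le: "i < m \<Longrightarrow> \<omega> \<in> space M \<Longrightarrow> \<bar>X i \<omega>\<bar> \<le> Q i \<omega>"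
    and Q_01: "i < m \<Longrightarrow> \<omega> \<in> space M \<Longrightarrow> Q i \<omega> = 0 \<or> Q i \<omega> = 1"
    and EX: "i < m \<Longrightarrow> expectation (X i) = s / N"
    and EQ: "i < m \<Longrightarrow> expectation (Q i) = J"
    and J: "0 \<le> J" "J \<le> 1"
    and s_le: "\<bar>s\<bar> \<le> N * J"
begin

lemma indep_fun:
  assumes "K \<subseteq> {..<m}" and "f \<in> borel_measurable (borel \<Otimes>\<^sub>M borel \<Otimes>\<^sub>M borel)"
  shows "indep_vars (\<lambda>_. borel) (\<lambda>i \<omega>. f (X i \<omega>, Q i \<omega>, Y i \<omega>)) K"
  by (rule indep_vars_compose2[OF indep_vars_subset[OF indep]]) (use assms in auto)

lemma measurable_samples [measurable]:
  assumes "i < m"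
  shows "X i \<in> borel_measurable M" "Q i \<in> borel_measurable M" "Y i \<in> borel_measurable M"
proof -
  have "(\<lambda>\<omega>. (X i \<omega>, Q i \<omega>, Y i \<omega>)) \<in> M \<rightarrow>\<^sub>M borel \<Otimes>\<^sub>M borel \<Otimes>\<^sub>M borel"
    using indep assms by (auto simp: indep_vars_def)
  note * = measurable_compose[OF this measurable_fst] measurable_compose[OF this measurable_snd]
  show "X i \<in> borel_measurable M" "Q i \<in> borel_measurable M" "Y i \<in> borel_measurable M"
    using *(1) measurable_compose[OF *(2) measurable_fst] measurable_compose[OF *(2) measurable_snd]
    by simp_all
qed

lemma moments:
  assumes i: "i < m"
  shows "integrable M (Q i)" "integrable M (X i)" "integrable M (Y i)"
    "integrable M (\<lambda>\<omega>. (Q i \<omega>)\<^sup>2)" "integrable M (\<lambda>\<omega>. (X i \<omega>)\<^sup>2)" "integrable M (\<lambda>\<omega>. (Y i \<omega>)\<^sup>2)"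
    "expectation (\<lambda>\<omega>. (Q i \<omega>)\<^sup>2) = J" "expectation (\<lambda>\<omega>. (X i \<omega>)\<^sup>2) \<le> J"
    "expectation (Y i) = 1 / N" "expectation (\<lambda>\<omega>. (Y i \<omega>)\<^sup>2) = 2 / N\<^sup>2"
proof -
  note [measurable] = measurable_samples[OF i]
  have le1: "\<bar>Q i \<omega>\<bar> \<le> 1" "\<bar>X i \<omega>\<bar> \<le> 1" "(Q i \<omega>)\<^sup>2 = Q i \<omega>" "(X i \<omega>)\<^sup>2 \<le> Q i \<omega>" if "\<omega> \<in> space M" for \<omega>
  proof -
    show "\<bar>Q i \<omega>\<bar> \<le> 1" "\<bar>X i \<omega>\<bar> \<le> 1" and q: "(Q i \<omega>)\<^sup>2 = Q i \<omega>"
      using Q_01[OF i that] X_le[OF i that] by auto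
    have "(X i \<omega>)\<^sup>2 \<le> (Q i \<omega>)\<^sup>2"
      using X_le[OF i that] by (intro power2_le_iff_abs_le[THEN iffD2]) auto
    then show "(X i \<omega>)\<^sup>2 \<le> Q i \<omega>" by (simp add: q)
  qed
  show Qi: "integrable M (Q i)" by (rule integrable_const_bound[where B=1]) (use le1 in auto)
  show "integrable M (X i)" by (rule integrable_const_bound[where B=1]) (use le1 in auto)
  show "integrable M (\<lambda>\<omega>. (Q i \<omega>)\<^sup>2)" by (rule integrable_const_bound[where B=1]) (use le1 in \<open>auto simp: abs_square_le_1\<close>)
  show X2: "integrable M (\<lambda>\<omega>. (X i \<omega>)\<^sup>2)" by (rule integrable_const_bound[where B=1]) (use le1 in \<open>auto simp: abs_square_le_1\<close>)
  have "expectation (\<lambda>\<omega>. (Q i \<omega>)\<^sup>2) = expectation (Q i)"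
    by (rule Bochner_Integration.integral_cong) (use le1 in auto)
  then show "expectation (\<lambda>\<omega>. (Q i \<omega>)\<^sup>2) = J" using EQ[OF i] by simp
  have "expectation (\<lambda>\<omega>. (X i \<omega>)\<^sup>2) \<le> expectation (Q i)"
    by (rule integral_mono) (use le1 X2 Qi in auto)
  then show "expectation (\<lambda>\<omega>. (X i \<omega>)\<^sup>2) \<le> J" using EQ[OF i] by simp
  show "expectation (Y i) = 1 / N"
    by (rule exponential_distributed_expectation[OF N_ge Y_exp[OF i]])
  show Y2: "integrable M (\<lambda>\<omega>. (Y i \<omega>)\<^sup>2)" "expectation (\<lambda>\<omega>. (Y i \<omega>)\<^sup>2) = 2 / N\<^sup>2"
    using exponential_second_moment[OF prob_space_axioms N_ge Y_exp[OF i]] by auto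
  show "integrable M (Y i)"
    by (rule square_integrable_imp_integrable[OF _ Y2(1)]) simp
qed

text \<open>Numerator and denominator have means \<open>k * s / N\<close> and \<open>k / N\<close>
  for \<open>k = card K\<close>, so the unknown \<open>N\<close> cancels. For empty \<open>K\<close>
  the value is \<open>0 / 0 = 0\<close>, the guess used when \<open>m \<le> 32\<close>.\<close>

definition ratio :: "nat set \<Rightarrow> 'a \<Rightarrow> real" where
  "ratio K \<omega> = (\<Sum>i\<in>K. X i \<omega>) / (\<Sum>i\<in>K. Y i \<omega>)"

text \<open>The good event of a group. The third bound lets the observable hit count stand in for
  the unknown \<open>card K * J\<close> when the width of the offset is chosen.\<close>

definition conc :: "nat set \<Rightarrow> 'a \<Rightarrow> bool" where
  "conc K \<omega> \<longleftrightarrow> ((\<Sum>i\<in>K. X i \<omega>) - s * (\<Sum>i\<in>K. Y i \<omega>))\<^sup>2 \<le> 96 * (real (card K) * J) \<and>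
     real (card K) / (2 * N) \<le> (\<Sum>i\<in>K. Y i \<omega>) \<and>
     ((\<Sum>i\<in>K. Q i \<omega>) - real (card K) * J)\<^sup>2 \<le> 16 * (real (card K) * J)"

lemma measurable_conc [measurable]:
  assumes "K \<subseteq> {..<m}"
  shows "{\<omega> \<in> space M. conc K \<omega>} \<in> events"
proof -
  have [measurable]: "i \<in> K \<Longrightarrow> X i \<in> borel_measurable M" "i \<in> K \<Longrightarrow> Y i \<in> borel_measurable M"
    "i \<in> K \<Longrightarrow> Q i \<in> borel_measurable M" for i
    using assms by (auto intro: measurable_samples)
  show ?thesis unfolding conc_def by measurable
qed

text \<open>The three failure probabilities add up to 1/16 + 1/16 + 1/8 = 1/4. The size 32 is what
  the denominator requires; for empty \<open>K\<close> all three bounds read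
  \<open>0 \<le> 0\<close>.\<close>

lemma prob_conc:
  assumes K: "K \<subseteq> {..<m}" and card: "K = {} \<or> 32 \<le> card K"
  shows "prob {\<omega> \<in> space M. conc K \<omega>} \<ge> 3 / 4"
proof (cases "K = {}")
  case True
  then have "{\<omega> \<in> space M. conc K \<omega>} = space M"
    by (auto simp: conc_def)
  then show ?thesis by (simp add: prob_space)
next
  case False
  let ?k = "real (card K)"
  have k: "?k \<ge> 32" and fin: "finite K" using card False K finite_subset by auto
  have im: "i \<in> K \<Longrightarrow> i < m" for i using K by auto
  have [measurable]: "i \<in> K \<Longrightarrow> X i \<in> borel_measurable M" "i \<in> K \<Longrightarrow> Y i \<in> borel_measurable M"
    "i \<in> K \<Longrightarrow> Q i \<in> borel_measurable M" for i
    using im by (auto intro: measurable_samples)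
  let ?D = "\<lambda>\<omega>. (\<Sum>i\<in>K. X i \<omega> - s * Y i \<omega>)\<^sup>2 \<le> 16 * (?k * (6 * J))"
  \<comment> \<open>The level is the square of \<open>k / (2 * N)\<close>, half the mean of the sum.
    It is \<open>k / 4\<close> times the variance, so it is exceeded with probability at most
    \<open>4 / k\<close>, hence at most 1/8.\<close>
  let ?T = "\<lambda>\<omega>. (\<Sum>i\<in>K. Y i \<omega> - 1 / N)\<^sup>2 \<le> (?k / 4) * (?k * (1 / N\<^sup>2))"
  let ?C = "\<lambda>\<omega>. (\<Sum>i\<in>K. Q i \<omega> - J)\<^sup>2 \<le> 16 * (?k * J)"
  have D: "prob {\<omega> \<in> space M. \<not> ?D \<omega>} \<le> 1 / 16"
  proof (rule indep_sum_deviation[OF fin])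
    show "indep_vars (\<lambda>_. borel) (\<lambda>i \<omega>. X i \<omega> - s * Y i \<omega>) K"
      using indep_fun[OF K, of "\<lambda>(x, q, y). x - s * y"] by simp
  next
    fix i assume "i \<in> K"
    note i = im[OF this]
    note mo = moments[OF i]
    note [measurable] = measurable_samples[OF i]
    \<comment> \<open>Independence of \<open>X i\<close> and \<open>Y i\<close> is not assumed, so
      the square is split without a mixed moment. This gives 2 J + 4 (s/N)^2, at most
      \<open>6 * J\<close> because \<open>\<bar>s / N\<bar> \<le> J \<le> 1\<close>; the 96 in
      \<open>conc\<close> is 16 times 6.\<close>
    have le: "(X i \<omega> - s * Y i \<omega>)\<^sup>2 \<le> 2 * (X i \<omega>)\<^sup>2 + 2 * s\<^sup>2 * (Y i \<omega>)\<^sup>2" for \<omega>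
    proof -
      have "0 \<le> (X i \<omega> + s * Y i \<omega>)\<^sup>2" by simp
      then show ?thesis by (simp add: power2_eq_square algebra_simps)
    qed
    have bi: "integrable M (\<lambda>\<omega>. 2 * (X i \<omega>)\<^sup>2 + 2 * s\<^sup>2 * (Y i \<omega>)\<^sup>2)"
      using mo by auto
    show int: "integrable M (\<lambda>\<omega>. (X i \<omega> - s * Y i \<omega>)\<^sup>2)"
      by (rule Bochner_Integration.integrable_bound[OF bi]) (use le in auto)
    show "expectation (\<lambda>\<omega>. X i \<omega> - s * Y i \<omega>) = 0"
      using mo EX[OF i] by simp
    have "expectation (\<lambda>\<omega>. (X i \<omega> - s * Y i \<omega>)\<^sup>2) \<le> expectation (\<lambda>\<omega>. 2 * (X i \<omega>)\<^sup>2 + 2 * s\<^sup>2 * (Y i \<omega>)\<^sup>2)"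
      by (rule integral_mono[OF int bi le])
    also have "\<dots> = 2 * expectation (\<lambda>\<omega>. (X i \<omega>)\<^sup>2) + 2 * s\<^sup>2 * (2 / N\<^sup>2)"
      using mo by simp
    also have "\<dots> \<le> 2 * J + 4 * (s / N)\<^sup>2"
      using mo by (simp add: power_divide)
    also have "(s / N)\<^sup>2 \<le> J"
    proof -
      have "\<bar>s / N\<bar> \<le> J" using s_le N_ge by (simp add: abs_divide field_simps)
      then have "(s / N)\<^sup>2 \<le> J\<^sup>2" using J by (intro power2_le_iff_abs_le[THEN iffD2]) auto
      also have "\<dots> \<le> J" using J by (simp add: power2_eq_square mult_left_le)
      finally show ?thesis .
    qed
    finally show "expectation (\<lambda>\<omega>. (X i \<omega> - s * Y i \<omega>)\<^sup>2) \<le> 6 * J" by simp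
  qed simp
  have C: "prob {\<omega> \<in> space M. \<not> ?C \<omega>} \<le> 1 / 16"
  proof (rule indep_sum_deviation[OF fin])
    show "indep_vars (\<lambda>_. borel) (\<lambda>i \<omega>. Q i \<omega> - J) K"
      using indep_fun[OF K, of "\<lambda>(x, q, y). q - J"] by simp
  next
    fix i assume "i \<in> K"
    note i = im[OF this]
    note mo = moments[OF i]
    show "integrable M (\<lambda>\<omega>. (Q i \<omega> - J)\<^sup>2)"
      using mo by (simp add: power2_diff)
    show "expectation (\<lambda>\<omega>. Q i \<omega> - J) = 0"
      using mo EQ[OF i] by (simp add: prob_space)
    have "expectation (\<lambda>\<omega>. (Q i \<omega> - J)\<^sup>2) = J - J\<^sup>2"
      using mo EQ[OF i] by (simp add: power2_diff prob_space) (simp add: power2_eq_square)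
    then show "expectation (\<lambda>\<omega>. (Q i \<omega> - J)\<^sup>2) \<le> J" by simp
  qed simp
  have "prob {\<omega> \<in> space M. \<not> ?T \<omega>} \<le> 1 / (?k / 4)"
  proof (rule indep_sum_deviation[OF fin])
    show "indep_vars (\<lambda>_. borel) (\<lambda>i \<omega>. Y i \<omega> - 1 / N) K"
      using indep_fun[OF K, of "\<lambda>(x, q, y). y - 1 / N"] by simp
  next
    fix i assume "i \<in> K"
    note i = im[OF this]
    note mo = moments[OF i]
    show "integrable M (\<lambda>\<omega>. (Y i \<omega> - 1 / N)\<^sup>2)"
      using mo by (simp add: power2_diff)
    show "expectation (\<lambda>\<omega>. Y i \<omega> - 1 / N) = 0"
      using mo by (simp add: prob_space)
    show "expectation (\<lambda>\<omega>. (Y i \<omega> - 1 / N)\<^sup>2) \<le> 1 / N\<^sup>2"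
      using exponential_distributed_variance[OF N_ge Y_exp[OF i]] mo(9) by simp
  qed (use k in auto)
  also have "\<dots> \<le> 1 / 8" using k by (simp add: field_simps)
  finally have T: "prob {\<omega> \<in> space M. \<not> ?T \<omega>} \<le> 1 / 8" .
  have sub: "space M - {\<omega> \<in> space M. conc K \<omega>} \<subseteq>
    {\<omega> \<in> space M. \<not> ?D \<omega>} \<union> {\<omega> \<in> space M. \<not> ?C \<omega>} \<union> {\<omega> \<in> space M. \<not> ?T \<omega>}"
  proof -
    have "?k / (2 * N) \<le> (\<Sum>i\<in>K. Y i \<omega>)" if "?T \<omega>" for \<omega>
    proof -
      have "(\<Sum>i\<in>K. Y i \<omega> - 1 / N)\<^sup>2 \<le> (?k / (2 * N))\<^sup>2"
        using that by (simp add: power2_eq_square)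
      then have "\<bar>\<Sum>i\<in>K. Y i \<omega> - 1 / N\<bar> \<le> ?k / (2 * N)"
        using N_ge by (subst (asm) power2_le_iff_abs_le) auto
      then show ?thesis by (simp add: sum_subtractf abs_le_iff field_simps)
    qed
    then show ?thesis
      unfolding conc_def by (auto simp: sum_subtractf sum_distrib_left)
  qed
  have "prob (space M - {\<omega> \<in> space M. conc K \<omega>}) \<le>
    prob ({\<omega> \<in> space M. \<not> ?D \<omega>} \<union> {\<omega> \<in> space M. \<not> ?C \<omega>} \<union> {\<omega> \<in> space M. \<not> ?T \<omega>})"
    by (rule finite_measure_mono[OF sub]) measurable
  also have "\<dots> \<le> prob ({\<omega> \<in> space M. \<not> ?D \<omega>} \<union> {\<omega> \<in> space M. \<not> ?C \<omega>}) + prob {\<omega> \<in> space M. \<not> ?T \<omega>}"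
    by (rule measure_Un_le) measurable
  also have "prob ({\<omega> \<in> space M. \<not> ?D \<omega>} \<union> {\<omega> \<in> space M. \<not> ?C \<omega>}) \<le>
      prob {\<omega> \<in> space M. \<not> ?D \<omega>} + prob {\<omega> \<in> space M. \<not> ?C \<omega>}"
    by (rule measure_Un_le) measurable
  finally have "prob (space M - {\<omega> \<in> space M. conc K \<omega>}) \<le> 1 / 4"
    using D C T by simp
  then show ?thesis using prob_compl[OF measurable_conc[OF K]] by simp
qed

text \<open>The error is the centred sum of the \<open>X i - s * Y i\<close> divided by a
  denominator of at least \<open>k / (2 * N)\<close>, which turns 96 into 4 * 96 = 384.\<close>

lemma conc_ratio:
  assumes "conc K \<omega>" and "K \<noteq> {}" "finite K"
  shows "(ratio K \<omega> - s)\<^sup>2 \<le> 384 * N\<^sup>2 * J / real (card K)"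
proof -
  let ?k = "real (card K)" and ?S = "\<Sum>i\<in>K. X i \<omega>" and ?Y = "\<Sum>i\<in>K. Y i \<omega>"
  have k: "?k > 0" using assms by (simp add: card_gt_0_iff)
  have Y: "?k / (2 * N) \<le> ?Y" and D: "(?S - s * ?Y)\<^sup>2 \<le> 96 * (?k * J)"
    using assms by (auto simp: conc_def)
  have kN: "0 < ?k / (2 * N)" using k N_ge by simp
  with Y have Ypos: "?Y > 0" by linarith
  have "ratio K \<omega> - s = (?S - s * ?Y) / ?Y"
    using Ypos by (simp add: ratio_def diff_divide_distrib)
  then have "(ratio K \<omega> - s)\<^sup>2 = (?S - s * ?Y)\<^sup>2 / ?Y\<^sup>2"
    by (simp add: power_divide)
  also have "\<dots> \<le> 96 * (?k * J) / (?k / (2 * N))\<^sup>2"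
    using D Y kN Ypos J k by (intro frac_le power_mono) auto
  also have "\<dots> = 384 * N\<^sup>2 * J / ?k"
    using k N_ge by (simp add: field_simps power2_eq_square)
  finally show ?thesis .
qed

lemma indep_groups:
  assumes "disjoint_family_on K L" and "\<And>l. l \<in> L \<Longrightarrow> K l \<subseteq> {..<m}"
    and "\<And>l. l \<in> L \<Longrightarrow> f l \<in> borel_measurable (PiM (K l) (\<lambda>_. borel \<Otimes>\<^sub>M borel \<Otimes>\<^sub>M borel))"
  shows "indep_vars (\<lambda>_. borel) (\<lambda>l \<omega>. f l (\<lambda>i\<in>K l. (X i \<omega>, Q i \<omega>, Y i \<omega>))) L"
  by (rule indep_vars_compose2[OF indep_vars_restrict[OF indep]]) (use assms in auto)

text \<open>Consecutive blocks of length \<open>k\<close> are independent groups, each failing with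
  probability at most 1/4. The event counts failing blocks; on it the median inherits the accuracy
  of a single good block.\<close>

lemma median_of_ratios:
  assumes k: "32 \<le> k" and g: "0 < g" "g * k \<le> m"
  shows "\<exists>E\<in>events. prob E \<ge> 1 - exp (- real g / 8) \<and>
    (\<forall>\<omega>\<in>E. \<bar>med g (\<lambda>l. ratio {l * k..<Suc l * k} \<omega>) - s\<bar> \<le> sqrt (384 * N\<^sup>2 * J / real k))"
proof -
  define K where "K l = {l * k..<Suc l * k}" for l
  have sub: "K l \<subseteq> {..<m}" if "l < g" for l
  proof -
    have "Suc l * k \<le> g * k" using that by (intro mult_right_mono) auto
    then show ?thesis using g by (auto simp: K_def)
  qed
  have card: "card (K l) = k" for l by (simp add: K_def)
  have disj: "disjoint_family_on K {..<g}"
  proof -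
    have "K i \<inter> K j = {}" if "i < j" for i j
    proof -
      have "Suc i * k \<le> j * k" using that by (intro mult_right_mono) auto
      then show ?thesis by (auto simp: K_def)
    qed
    then show ?thesis unfolding disjoint_family_on_def by (metis inf_commute linorder_neqE_nat)
  qed
  \<comment> \<open>The negation of \<open>conc\<close> as a function of the samples of block
    \<open>l\<close> alone, the form in which independence of the blocks applies.\<close>
  let ?f = "\<lambda>l r. of_bool (\<not> (((\<Sum>i\<in>K l. fst (r i)) - s * (\<Sum>i\<in>K l. snd (snd (r i))))\<^sup>2 \<le> 96 * (real k * J) \<and>
     real k / (2 * N) \<le> (\<Sum>i\<in>K l. snd (snd (r i))) \<and>
     ((\<Sum>i\<in>K l. fst (snd (r i))) - real k * J)\<^sup>2 \<le> 16 * (real k * J))) :: real"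
  have "indep_vars (\<lambda>_. borel) (\<lambda>l \<omega>. ?f l (\<lambda>i\<in>K l. (X i \<omega>, Q i \<omega>, Y i \<omega>))) {..<g}"
    by (rule indep_groups[OF disj]) (use sub in auto)
  also have "(\<lambda>l \<omega>. ?f l (\<lambda>i\<in>K l. (X i \<omega>, Q i \<omega>, Y i \<omega>))) = (\<lambda>l \<omega>. of_bool (\<not> conc (K l) \<omega>))"
    by (intro ext) (simp add: conc_def card)
  finally have ind: "indep_vars (\<lambda>_. borel) (\<lambda>l \<omega>. of_bool (\<not> conc (K l) \<omega>) :: real) {..<g}" .
  have bad: "prob {\<omega> \<in> space M. \<not> conc (K l) \<omega>} \<le> 1 / 4" if "l < g" for l
  proof -
    have eq: "{\<omega> \<in> space M. \<not> conc (K l) \<omega>} = space M - {\<omega> \<in> space M. conc (K l) \<omega>}" by auto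
    have "3 / 4 \<le> prob {\<omega> \<in> space M. conc (K l) \<omega>}"
      using prob_conc[OF sub[OF that]] card k by simp
    then show ?thesis
      unfolding eq prob_compl[OF measurable_conc[OF sub[OF that]]] by linarith
  qed
  let ?E = "{\<omega> \<in> space M. 2 * card {l. l < g \<and> \<not> conc (K l) \<omega>} < g}"
  have "\<bar>med g (\<lambda>l. ratio (K l) \<omega>) - s\<bar> \<le> sqrt (384 * N\<^sup>2 * J / real k)" (is "_ \<le> ?r") if "\<omega> \<in> ?E" for \<omega>
  proof -
    have "conc (K l) \<omega> \<Longrightarrow> s - ?r \<le> ratio (K l) \<omega> \<and> ratio (K l) \<omega> \<le> s + ?r" for l
    proof -
      assume c: "conc (K l) \<omega>"
      have "K l \<noteq> {}" using card[of l] k by auto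
      then have "(ratio (K l) \<omega> - s)\<^sup>2 \<le> 384 * N\<^sup>2 * J / real k"
        using conc_ratio[OF c] card by (simp add: K_def)
      then have "\<bar>ratio (K l) \<omega> - s\<bar> \<le> ?r" by (rule real_le_rsqrt[of "\<bar>_\<bar>", simplified])
      then show ?thesis by linarith
    qed
    then have "card {l. l < g \<and> \<not> (s - ?r \<le> ratio (K l) \<omega> \<and> ratio (K l) \<omega> \<le> s + ?r)}
      \<le> card {l. l < g \<and> \<not> conc (K l) \<omega>}"
      by (intro card_mono) auto
    moreover have "2 * card {l. l < g \<and> \<not> conc (K l) \<omega>} < g" using that by simp
    ultimately have "2 * card {l. l < g \<and> \<not> (s - ?r \<le> ratio (K l) \<omega> \<and> ratio (K l) \<omega> \<le> s + ?r)} < g"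
      by linarith
    from med_between[OF this] show ?thesis by linarith
  qed
  then show ?thesis
    using majority[OF ind bad g(1)] unfolding K_def by blast
qed

section \<open>The random offset for few samples\<close>

text \<open>With \<open>L = scale4 (1 / N)\<close> the offset is affine of slope 2 / L^2 on [L, 2L),
  so the favourable values of \<open>Y i\<close> contain an interval of length \<open>\<rho>\<close>
  there. Its mass is at least \<open>N * \<rho> * exp (- 2)\<close>, where
  \<open>N * \<rho> \<ge> \<tau> / 64\<close> and \<open>exp 2 \<le> 9\<close>; 64 * 9 =
  576.\<close>

lemma scale4_window:
  assumes i: "i < m" and \<theta>: "\<bar>\<theta>\<bar> \<le> N" and \<tau>: "0 < \<tau>" "\<tau> \<le> 1"
  shows "prob {\<omega> \<in> space M. Y i \<omega> / scale4 (Y i \<omega>) < 2 \<and>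
      \<bar>(2 * (Y i \<omega> / scale4 (Y i \<omega>)) - 3) / scale4 (Y i \<omega>) - \<theta>\<bar> \<le> \<tau> * N} \<ge> \<tau> / 576"
    (is "prob ?A \<ge> _")
proof -
  note [measurable] = measurable_samples[OF i]
  define L where "L = scale4 (1 / N)"
  have L: "L > 0" "L * N \<le> 1" "1 < 4 * (L * N)"
    using scale4_bounds[of "1 / N"] N_ge by (auto simp: L_def scale4_def field_simps)
  \<comment> \<open>The point at which the offset equals \<open>\<theta>\<close>. It lies in [L, 2L]
    because \<open>\<bar>\<theta> * L\<bar> \<le> 1\<close>.\<close>
  define c where "c = L * (3 + \<theta> * L) / 2"
  \<comment> \<open>Moving by \<open>2 * \<rho>\<close> away from \<open>c\<close> changes the
    offset by 4 \<rho> / L^2, which is exactly the tolerance \<open>\<tau> * N\<close>.\<close>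
  define \<rho> where "\<rho> = \<tau> * (L * N) * L / 4"
  have "\<bar>\<theta> * L\<bar> \<le> N * L" using \<theta> L by (simp add: abs_mult mult_right_mono)
  then have tl: "\<bar>\<theta> * L\<bar> \<le> 1" using L by (simp add: mult.commute)
  have c: "L \<le> c" "c \<le> 2 * L"
  proof -
    have "L * 2 \<le> L * (3 + \<theta> * L)" "L * (3 + \<theta> * L) \<le> L * 4"
      using L tl by (auto intro!: mult_left_mono)
    then show "L \<le> c" "c \<le> 2 * L" by (auto simp: c_def)
  qed
  have "\<tau> * (L * N) \<le> 1" by (rule mult_le_one) (use \<tau> L N_ge in auto)
  then have r: "0 < \<rho>" "\<rho> \<le> L / 4"
    using \<tau> L N_ge mult_right_mono[of "\<tau> * (L * N)" 1 L] by (auto simp: \<rho>_def)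
  \<comment> \<open>The interval is laid on the side of \<open>c\<close> on which it stays within
    [L, 2L). Starting at \<open>c - 2 * \<rho>\<close> rather than \<open>c - \<rho>\<close> keeps
    its right end strictly below \<open>2 * L\<close> even for \<open>c = 2 * L\<close>.\<close>
  define x where "x = (if c \<le> 3 * L / 2 then c else c - 2 * \<rho>)"
  have x: "L \<le> x" "x + \<rho> < 2 * L" "c - 2 * \<rho> \<le> x" "x + \<rho> \<le> c + 2 * \<rho>"
    using c r L by (auto simp: x_def)
  have sub: "{\<omega> \<in> space M. x < Y i \<omega> \<and> Y i \<omega> \<le> x + \<rho>} \<subseteq> ?A"
  proof safe
    fix \<omega> assume y: "x < Y i \<omega>" "Y i \<omega> \<le> x + \<rho>"
    have sc: "scale4 (Y i \<omega>) = L"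
      unfolding L_def using N_ge x y by (intro scale4_eq) (auto simp: L_def)
    show "Y i \<omega> / scale4 (Y i \<omega>) < 2" using sc L x y by (simp add: field_simps)
    have "(2 * (Y i \<omega> / L) - 3) / L = (2 * Y i \<omega> - 3 * L) / (L * L)" "\<theta> = \<theta> * (L * L) / (L * L)"
      using L by (simp_all add: diff_divide_distrib)
    then have "(2 * (Y i \<omega> / L) - 3) / L - \<theta> = (2 * Y i \<omega> - 3 * L - \<theta> * (L * L)) / (L * L)"
      by (metis diff_divide_distrib)
    also have "2 * Y i \<omega> - 3 * L - \<theta> * (L * L) = 2 * (Y i \<omega> - c)"
      by (simp add: c_def algebra_simps)
    finally have "(2 * (Y i \<omega> / L) - 3) / L - \<theta> = 2 * (Y i \<omega> - c) / (L * L)" .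
    moreover have "\<bar>Y i \<omega> - c\<bar> \<le> 2 * \<rho>" using x y by auto
    then have "2 * \<bar>Y i \<omega> - c\<bar> / (L * L) \<le> 4 * \<rho> / (L * L)"
      using L by (intro divide_right_mono) auto
    moreover have "\<bar>2 * (Y i \<omega> - c) / (L * L)\<bar> = 2 * \<bar>Y i \<omega> - c\<bar> / (L * L)"
      using L by (simp only: abs_divide abs_mult)
    moreover have "4 * \<rho> / (L * L) = \<tau> * N" using L by (simp add: \<rho>_def)
    ultimately show "\<bar>(2 * (Y i \<omega> / scale4 (Y i \<omega>)) - 3) / scale4 (Y i \<omega>) - \<theta>\<bar> \<le> \<tau> * N"
      unfolding sc by linarith
  qed
  have "1 / 4 * (1 / 4) \<le> (L * N) * (L * N)" using L by (intro mult_mono) auto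
  then have NL: "\<tau> / 64 \<le> N * \<rho>"
    using mult_left_mono[of "1 / 4 * (1 / 4)" "(L * N) * (L * N)" "\<tau> / 4"] \<tau> by (simp add: \<rho>_def algebra_simps)
  have "exp 2 \<le> (9::real)"
  proof -
    have "exp 2 = exp 1 * exp (1::real)" by (simp add: exp_add[symmetric])
    also have "\<dots> \<le> 3 * 3" using exp_le by (intro mult_mono) auto
    finally show ?thesis by simp
  qed
  then have e: "1 / 9 \<le> exp (- 2 :: real)" by (simp add: exp_minus field_simps)
  have "(x + \<rho>) * N \<le> 2 * L * N" using x N_ge by (intro mult_right_mono) auto
  then have "- 2 \<le> - ((x + \<rho>) * N)" using L by linarith
  then have "- 2 \<le> - (x + \<rho>) * N" by (simp only: minus_mult_left)
  then have "1 / 9 \<le> exp (- (x + \<rho>) * N)" by (rule order_trans[OF e exp_le_cancel_iff[THEN iffD2]])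
  then have "\<tau> / 64 * (1 / 9) \<le> N * \<rho> * exp (- (x + \<rho>) * N)"
    using NL \<tau> by (intro mult_mono) auto
  also have "\<dots> \<le> prob {\<omega> \<in> space M. x < Y i \<omega> \<and> Y i \<omega> \<le> x + \<rho>}"
    by (rule exponential_interval_ge[OF Y_exp[OF i] N_ge]) (use x L r in auto)
  also have "\<dots> \<le> prob ?A" by (rule finite_measure_mono[OF sub]) measurable
  finally show ?thesis by simp
qed

text \<open>The range (2L, 3L] lies in the part of the class of \<open>L\<close> on which the
  estimator returns 0. Its mass is at least \<open>N * L * exp (- 3)\<close>, and
  \<open>N * L > 1 / 4\<close>, \<open>exp 3 \<le> 27\<close>.\<close>

lemma scale4_upper:
  assumes i: "i < m"
  shows "prob {\<omega> \<in> space M. \<not> Y i \<omega> / scale4 (Y i \<omega>) < 2} \<ge> 1 / 108" (is "prob ?A \<ge> _")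
proof -
  note [measurable] = measurable_samples[OF i]
  define L where "L = scale4 (1 / N)"
  have L: "L > 0" "L * N \<le> 1" "1 < 4 * (L * N)"
    using scale4_bounds[of "1 / N"] N_ge by (auto simp: L_def scale4_def field_simps)
  have sub: "{\<omega> \<in> space M. 2 * L < Y i \<omega> \<and> Y i \<omega> \<le> 2 * L + L} \<subseteq> ?A"
  proof safe
    fix \<omega> assume y: "2 * L < Y i \<omega>" "Y i \<omega> \<le> 2 * L + L"
    have "scale4 (Y i \<omega>) = L"
      unfolding L_def using N_ge L y by (intro scale4_eq) (auto simp: L_def)
    moreover assume "Y i \<omega> / scale4 (Y i \<omega>) < 2"
    ultimately show False using L y by (simp add: field_simps)
  qed
  have "exp 3 \<le> (27::real)"
  proof -
    have "exp 3 = exp 1 * exp 1 * exp (1::real)" by (simp add: exp_add[symmetric])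
    also have "\<dots> \<le> 3 * 3 * 3" using exp_le by (intro mult_mono) auto
    finally show ?thesis by simp
  qed
  then have e: "1 / 27 \<le> exp (- 3 :: real)" by (simp add: exp_minus field_simps)
  have "- 3 \<le> - (2 * L + L) * N" using L by simp
  then have "1 / 27 \<le> exp (- (2 * L + L) * N)" by (rule order_trans[OF e exp_le_cancel_iff[THEN iffD2]])
  then have "1 / 4 * (1 / 27) \<le> N * L * exp (- (2 * L + L) * N)"
    using L by (intro mult_mono) (auto simp: mult.commute)
  also have "\<dots> \<le> prob {\<omega> \<in> space M. 2 * L < Y i \<omega> \<and> Y i \<omega> \<le> 2 * L + L}"
    by (rule exponential_interval_ge[OF Y_exp[OF i] N_ge]) (use L in auto)
  also have "\<dots> \<le> prob ?A" by (rule finite_measure_mono[OF sub]) measurable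
  finally show ?thesis by simp
qed

end

text \<open>With \<open>L = scale4 y\<close>, the offset sweeps \<open>[-1/L, 1/L]\<close> linearly while \<open>y\<close> runs through
  \<open>[L, 2L)\<close>. For \<open>y\<close> exponential with rate \<open>N\<close> and \<open>L = scale4 (1/N)\<close>, this range contains
  \<open>[-N, N]\<close> and the density of the offset there is at least a constant over \<open>N\<close>, although the
  estimator does not know \<open>N\<close>.\<close>
definition dithered :: "real \<Rightarrow> real \<Rightarrow> real \<Rightarrow> real" where
  "dithered r t y = (if y / scale4 y < 2 then r + t * ((2 * (y / scale4 y) - 3) / scale4 y) else 0)"

context exp_samples
begin

text \<open>The width of the offset has to be computed from the sketches, whereas the right scale
  \<open>sqrt (card K * J)\<close> involves the unknown \<open>J\<close>; the hit count replaces it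
  up to constants. Adding 1 keeps the width positive when there are no hits.\<close>

lemma conc_dither_width:
  assumes "conc K \<omega>" and K: "K \<subseteq> {..<m}" and \<omega>: "\<omega> \<in> space M"
  defines "x \<equiv> sqrt (real (card K) * J)" and "y \<equiv> sqrt ((\<Sum>i\<in>K. Q i \<omega>) + 1)"
  shows "1 \<le> y" "x \<le> 5 * y" "y \<le> x + 4"
proof -
  let ?q = "\<Sum>i\<in>K. Q i \<omega>"
  have "0 \<le> Q i \<omega>" if "i \<in> K" for i using Q_01[of i \<omega>] K \<omega> that by fastforce
  then have q: "0 \<le> ?q" by (rule sum_nonneg)
  then show y1: "1 \<le> y" by (simp add: y_def)
  have x0: "0 \<le> x" and x2: "x\<^sup>2 = real (card K) * J" using J by (auto simp: x_def)
  have y2: "y\<^sup>2 = ?q + 1" using q by (simp add: y_def)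
  have "(?q - x\<^sup>2)\<^sup>2 \<le> (4 * x)\<^sup>2"
    using assms(1) by (simp add: conc_def x2 power_mult_distrib)
  then have "\<bar>?q - x\<^sup>2\<bar> \<le> 4 * x"
    using x0 by (subst (asm) power2_le_iff_abs_le) auto
  then have 1: "x\<^sup>2 - 4 * x \<le> ?q" and 2: "?q \<le> x\<^sup>2 + 4 * x" by linarith+
  show "x \<le> 5 * y"
  proof (rule ccontr)
    assume "\<not> x \<le> 5 * y"
    \<comment> \<open>As \<open>y \<ge> 1\<close>, \<open>x > 5 * y\<close> also gives
      \<open>x - 4 \<ge> y\<close>. Multiplying, 5 y^2 is at most x^2 - 4 x, hence at most the hit
      count, which is only y^2 - 1.\<close>
    then have "5 * y \<le> x" "y \<le> x - 4" using y1 by linarith+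
    then have "(5 * y) * y \<le> x * (x - 4)" using y1 by (intro mult_mono) auto
    then have "5 * y\<^sup>2 \<le> ?q" using 1 by (simp add: power2_eq_square algebra_simps)
    with y2 q show False by linarith
  qed
  have "y\<^sup>2 \<le> (x + 4)\<^sup>2" using y2 2 x0 by (simp add: power2_eq_square algebra_simps)
  then show "y \<le> x + 4" using x0 by (rule power2_le_imp_le[OF _ add_nonneg_nonneg]) simp
qed

text \<open>Sample 0 is reserved for the offset, which is thereby independent of the ratio formed
  from the other samples. For \<open>m \<le> 32\<close> fewer than 32 samples would remain, too few
  for \<open>prob_conc\<close>, so \<open>K\<close> is empty and the ratio is 0.\<close>

lemma dithered_ratio:
  assumes \<epsilon>: "0 < \<epsilon>" "\<epsilon> < 1" and m: "1 \<le> m" "real m * \<epsilon>\<^sup>2 \<le> 768"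
  defines "K \<equiv> (if m \<le> 32 then {} else {1..<m})"
  shows "\<exists>E\<in>events. prob E \<ge> real m * \<epsilon>\<^sup>2 / 10 ^ 7 \<and>
    (\<forall>\<omega>\<in>E. \<bar>dithered (ratio K \<omega>) (200 * sqrt ((\<Sum>i\<in>K. Q i \<omega>) + 1) / real m) (Y 0 \<omega>) - s\<bar>
      \<le> \<epsilon> * N * sqrt (J / 2))"
proof (cases "J \<le> \<epsilon>\<^sup>2 / 2")
  case True
  have m0: "0 < m" using m by simp
  note [measurable] = measurable_samples[OF m0]
  let ?E = "{\<omega> \<in> space M. \<not> Y 0 \<omega> / scale4 (Y 0 \<omega>) < 2}"
  \<comment> \<open>For such small \<open>J\<close> the answer 0 is accurate enough:
    \<open>\<bar>s\<bar> \<le> N * J\<close>, and J^2 is at most (\<epsilon>^2 / 2) J.\<close>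
  have "J\<^sup>2 \<le> \<epsilon>\<^sup>2 / 2 * J"
    unfolding power2_eq_square[of J] by (rule mult_right_mono[OF True J(1)])
  also have "\<dots> = (\<epsilon> * sqrt (J / 2))\<^sup>2"
    using J by (simp add: power_mult_distrib)
  finally have "J \<le> \<epsilon> * sqrt (J / 2)"
    by (rule power2_le_imp_le) (use \<epsilon> J in simp)
  then have "N * J \<le> N * (\<epsilon> * sqrt (J / 2))" using N_ge by (intro mult_left_mono) auto
  then have s: "\<bar>s\<bar> \<le> \<epsilon> * N * sqrt (J / 2)" using s_le by (simp add: mult_ac)
  have "real m * \<epsilon>\<^sup>2 / 10 ^ 7 \<le> 768 / 10 ^ 7" using m by (intro divide_right_mono) auto
  also have "\<dots> \<le> 1 / (108::real)" by simp
  also have "\<dots> \<le> prob ?E" by (rule scale4_upper[OF m0])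
  finally have p: "prob ?E \<ge> real m * \<epsilon>\<^sup>2 / 10 ^ 7" .
  have E: "?E \<in> events" by measurable
  show ?thesis
  proof (intro bexI[OF _ E] conjI p ballI)
    fix \<omega> assume "\<omega> \<in> ?E"
    then show "\<bar>dithered (ratio K \<omega>) (200 * sqrt ((\<Sum>i\<in>K. Q i \<omega>) + 1) / real m) (Y 0 \<omega>) - s\<bar>
      \<le> \<epsilon> * N * sqrt (J / 2)"
      using s by (simp add: dithered_def)
  qed
next
  case False
  have m0: "0 < m" using m by simp
  note [measurable] = measurable_samples[OF m0]
  have K: "K \<subseteq> {1..<m}" "K = {} \<or> 32 \<le> card K" "finite K" by (auto simp: K_def)
  then have Km: "K \<subseteq> {..<m}" by auto
  have [measurable]: "i \<in> K \<Longrightarrow> X i \<in> borel_measurable M" "i \<in> K \<Longrightarrow> Y i \<in> borel_measurable M"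
    "i \<in> K \<Longrightarrow> Q i \<in> borel_measurable M" for i
    using Km by (auto intro: measurable_samples)
  define y where "y \<omega> = sqrt ((\<Sum>i\<in>K. Q i \<omega>) + 1)" for \<omega>
  \<comment> \<open>The tolerance for hitting the target. Multiplied by \<open>N\<close> and the
    width \<open>200 * y \<omega> / m\<close> it leaves an error of \<epsilon>^2 N y / 50, while
    \<open>\<tau> / 576 * (3 / 4)\<close> is still at least the claimed probability.\<close>
  define \<tau> where "\<tau> = real m * \<epsilon>\<^sup>2 / 10 ^ 4"
  have \<tau>: "0 < \<tau>" "\<tau> \<le> 1" using m \<epsilon> by (auto simp: \<tau>_def)
  define \<theta> where "\<theta> \<omega> = (s - ratio K \<omega>) / (200 * y \<omega> / real m)" for \<omega>
  \<comment> \<open>When \<open>conc\<close> fails, the target is placed outside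
    \<open>{- N..N}\<close>, so that membership in this interval forces concentration.
    \<open>Z\<close> is a function of the samples in \<open>K\<close> only, hence independent of
    \<open>Y 0\<close>.\<close>
  define Z where "Z \<omega> = (if conc K \<omega> then \<theta> \<omega> else 2 * N)" for \<omega>
  let ?R = "\<lambda>u z. u / scale4 u < 2 \<and> \<bar>(2 * (u / scale4 u) - 3) / scale4 u - z\<bar> \<le> \<tau> * N"
  \<comment> \<open>This fixes the factor 200 in the width. With \<open>k = card K = m - 1\<close>
    the ratio errs by at most \<open>20 * N * sqrt (k * J) / k\<close>, hence by
    \<open>100 * N * y \<omega> / (m - 1)\<close>, hence by \<open>200 * N * y \<omega> / m\<close>.
    For empty \<open>K\<close> the error is \<open>\<bar>s\<bar> \<le> N\<close>, and
    \<open>200 / m > 1\<close>.\<close>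
  have \<theta>: "\<bar>\<theta> \<omega>\<bar> \<le> N" if c: "conc K \<omega>" and \<omega>: "\<omega> \<in> space M" for \<omega>
  proof -
    note w = conc_dither_width[OF c Km \<omega>, folded y_def]
    have "\<bar>s - ratio K \<omega>\<bar> \<le> N * (200 * y \<omega> / real m)"
    proof (cases "K = {}")
      case True
      then have "m \<le> 32" using m by (auto simp: K_def split: if_splits)
      have "\<bar>s\<bar> \<le> N * 1" using s_le J N_ge by (meson mult_left_mono order_trans less_imp_le)
      also have "\<dots> \<le> N * (200 * y \<omega> / real m)"
        using w(1) \<open>m \<le> 32\<close> m N_ge by (intro mult_left_mono) (auto simp: field_simps)
      finally show ?thesis using True by (simp add: ratio_def)
    next
      case False
      then have k: "real (card K) = real m - 1" "real m > 32" by (auto simp: K_def split: if_splits)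
      have "(ratio K \<omega> - s)\<^sup>2 \<le> 384 * N\<^sup>2 * J / real (card K)"
        by (rule conc_ratio[OF c False K(3)])
      also have "\<dots> = 384 * (N * sqrt (real (card K) * J) / real (card K))\<^sup>2"
      proof -
        have "(N * sqrt (real (card K) * J) / real (card K))\<^sup>2 = N\<^sup>2 * (real (card K) * J) / (real (card K))\<^sup>2"
          using J by (simp add: power_mult_distrib power_divide)
        also have "\<dots> = N\<^sup>2 * J / real (card K)"
          by (simp add: power2_eq_square)
        finally show ?thesis by simp
      qed
      also have "\<dots> \<le> 400 * (N * sqrt (real (card K) * J) / real (card K))\<^sup>2"
        by (intro mult_right_mono) auto
      also have "\<dots> = (20 * (N * sqrt (real (card K) * J) / real (card K)))\<^sup>2"
        by (simp only: power_mult_distrib[of 20]) simp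
      finally have "\<bar>ratio K \<omega> - s\<bar> \<le> 20 * (N * sqrt (real (card K) * J) / real (card K))"
        using N_ge J by (subst (asm) power2_le_iff_abs_le) auto
      also have "\<dots> \<le> 20 * (N * (5 * y \<omega>) / real (card K))"
        using w(2) N_ge by (intro mult_left_mono divide_right_mono) auto
      also have "\<dots> = N * y \<omega> * (100 / (real m - 1))" using k by simp
      also have "\<dots> \<le> N * y \<omega> * (200 / real m)"
        using k N_ge w(1) by (intro mult_left_mono) (auto simp: field_simps)
      finally show ?thesis by (simp add: abs_minus_commute mult_ac)
    qed
    moreover have t: "0 < 200 * y \<omega> / real m" using w m by auto
    ultimately show ?thesis
      unfolding \<theta>_def abs_divide[of "s - ratio K \<omega>"] abs_of_pos[OF t] pos_divide_le_eq[OF t] by simp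
  qed
  have ind: "indep_var borel (Y 0) borel Z"
  proof -
    let ?T = "\<lambda>\<omega> i. (X i \<omega>, Q i \<omega>, Y i \<omega>)"
    let ?B = "borel \<Otimes>\<^sub>M borel \<Otimes>\<^sub>M borel :: (real \<times> real \<times> real) measure"
    let ?h = "\<lambda>r. if ((\<Sum>i\<in>K. fst (r i)) - s * (\<Sum>i\<in>K. snd (snd (r i))))\<^sup>2 \<le> 96 * (real (card K) * J) \<and>
         real (card K) / (2 * N) \<le> (\<Sum>i\<in>K. snd (snd (r i))) \<and>
         ((\<Sum>i\<in>K. fst (snd (r i))) - real (card K) * J)\<^sup>2 \<le> 16 * (real (card K) * J)
       then (s - (\<Sum>i\<in>K. fst (r i)) / (\<Sum>i\<in>K. snd (snd (r i)))) / (200 * sqrt ((\<Sum>i\<in>K. fst (snd (r i))) + 1) / real m)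
       else 2 * N"
    have h: "?h \<in> borel_measurable (PiM K (\<lambda>_. ?B))" by measurable
    have g: "(\<lambda>r. snd (snd (r 0))) \<in> borel_measurable (PiM {0::nat} (\<lambda>_. ?B))" by measurable
    have "indep_var (PiM {0} (\<lambda>_. ?B)) (\<lambda>\<omega>. \<lambda>i\<in>{0}. ?T \<omega> i) (PiM K (\<lambda>_. ?B)) (\<lambda>\<omega>. \<lambda>i\<in>K. ?T \<omega> i)"
      by (rule indep_var_restrict[OF indep]) (use K m0 in auto)
    from indep_var_compose[OF this g h]
    have "indep_var borel (\<lambda>\<omega>. snd (snd ((\<lambda>i\<in>{0}. ?T \<omega> i) 0))) borel (\<lambda>\<omega>. ?h (\<lambda>i\<in>K. ?T \<omega> i))"
      by (simp only: comp_def)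
    also have "(\<lambda>\<omega>. snd (snd ((\<lambda>i\<in>{0}. ?T \<omega> i) 0))) = Y 0" by simp
    also have "(\<lambda>\<omega>. ?h (\<lambda>i\<in>K. ?T \<omega> i)) = Z"
      by (intro ext) (simp add: Z_def conc_def \<theta>_def y_def ratio_def)
    finally show ?thesis .
  qed
  then have [measurable]: "Z \<in> borel_measurable M" by (rule indep_var_rv2)
  let ?E = "{\<omega> \<in> space M. Z \<omega> \<in> {- N..N} \<and> ?R (Y 0 \<omega>) (Z \<omega>)}"
  have E: "?E \<in> events" by measurable
  have "3 / 4 \<le> prob {\<omega> \<in> space M. conc K \<omega>}" by (rule prob_conc[OF Km K(2)])
  also have "\<dots> \<le> prob {\<omega> \<in> space M. Z \<omega> \<in> {- N..N}}"
  proof (rule finite_measure_mono)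
    show "{\<omega> \<in> space M. conc K \<omega>} \<subseteq> {\<omega> \<in> space M. Z \<omega> \<in> {- N..N}}"
    proof (intro subsetI CollectI conjI)
      fix \<omega> assume "\<omega> \<in> {\<omega> \<in> space M. conc K \<omega>}"
      then have "conc K \<omega>" "\<omega> \<in> space M" by auto
      then show "Z \<omega> \<in> {- N..N}" "\<omega> \<in> space M" using \<theta>[of \<omega>] by (auto simp: Z_def)
    qed
  qed measurable
  finally have "\<tau> / 576 * (3 / 4) \<le> \<tau> / 576 * prob {\<omega> \<in> space M. Z \<omega> \<in> {- N..N}}"
    using \<tau> by (intro mult_left_mono) auto
  also have "\<dots> \<le> prob ?E"
  proof (rule prob_indep_fiberwise_ge[OF ind])
    show "{x \<in> space (borel \<Otimes>\<^sub>M borel). ?R (fst x) (snd x)} \<in> sets (borel \<Otimes>\<^sub>M borel)" by measurable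
    show "\<tau> / 576 \<le> prob {\<omega> \<in> space M. ?R (Y 0 \<omega>) z}" if "z \<in> {- N..N}" for z
      using that by (intro scale4_window[OF m0 _ \<tau>]) auto
  qed simp
  finally have "\<tau> / 576 * (3 / 4) \<le> prob ?E" .
  moreover have "real m * \<epsilon>\<^sup>2 / 10 ^ 7 \<le> \<tau> / 576 * (3 / 4)" unfolding \<tau>_def by simp
  ultimately have p: "real m * \<epsilon>\<^sup>2 / 10 ^ 7 \<le> prob ?E" by linarith
  have good: "\<bar>dithered (ratio K \<omega>) (200 * y \<omega> / real m) (Y 0 \<omega>) - s\<bar> \<le> \<epsilon> * N * sqrt (J / 2)"
    if "\<omega> \<in> ?E" for \<omega>
  proof -
    have \<omega>: "\<omega> \<in> space M" and R: "?R (Y 0 \<omega>) (Z \<omega>)" and Z: "Z \<omega> \<le> N" using that by auto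
    then have c: "conc K \<omega>" and Zt: "Z \<omega> = \<theta> \<omega>" using N_ge by (auto simp: Z_def split: if_splits)
    note w = conc_dither_width[OF c Km \<omega>, folded y_def]
    let ?W = "(2 * (Y 0 \<omega> / scale4 (Y 0 \<omega>)) - 3) / scale4 (Y 0 \<omega>)" and ?t = "200 * y \<omega> / real m"
    have t: "0 < ?t" using w m by auto
    then have "?t * \<theta> \<omega> = s - ratio K \<omega>"
      unfolding \<theta>_def by (metis less_irrefl nonzero_mult_div_cancel_left times_divide_eq_right)
    then have "s = ratio K \<omega> + ?t * \<theta> \<omega>" by simp
    then have "dithered (ratio K \<omega>) ?t (Y 0 \<omega>) - s = ?t * (?W - \<theta> \<omega>)"
      using R by (simp add: dithered_def right_diff_distrib)
    then have "\<bar>dithered (ratio K \<omega>) ?t (Y 0 \<omega>) - s\<bar> = ?t * \<bar>?W - \<theta> \<omega>\<bar>"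
      using t by (simp only: abs_mult abs_of_pos)
    also have "\<dots> \<le> ?t * (\<tau> * N)" using R t by (intro mult_left_mono) (auto simp: Zt)
    also have "\<dots> = N * \<epsilon> * (\<epsilon> * y \<omega> / 50)" using m by (simp add: \<tau>_def power2_eq_square)
    \<comment> \<open>With r = \<open>sqrt (J / 2)\<close>, the case assumption gives \<epsilon>
      \<le> 2 r, and m \<epsilon>^2 \<le> 768 gives \<open>\<epsilon> * sqrt (card K * J)\<close>
      \<le> 40 r. As \<open>y \<omega> \<le> sqrt (card K * J) + 4\<close>, the product
      \<open>\<epsilon> * y \<omega>\<close> is at most 48 r.\<close>
    also have "\<epsilon> * y \<omega> / 50 \<le> sqrt (J / 2)"
    proof -
      let ?r = "sqrt (J / 2)"
      have r0: "0 \<le> ?r" and r2: "?r\<^sup>2 = J / 2" using J by auto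
      have "\<epsilon>\<^sup>2 \<le> (2 * ?r)\<^sup>2" using False by (simp add: power_mult_distrib r2)
      then have e1: "\<epsilon> \<le> 2 * ?r" by (rule power2_le_imp_le) (use r0 in simp)
      have "(\<epsilon> * sqrt (real (card K) * J))\<^sup>2 = (\<epsilon>\<^sup>2 * real (card K)) * J"
        using J by (simp add: power_mult_distrib)
      also have "\<dots> \<le> 768 * J"
      proof (rule mult_right_mono)
        have "card K \<le> m" using card_mono[OF _ Km] by simp
        then have "\<epsilon>\<^sup>2 * real (card K) \<le> \<epsilon>\<^sup>2 * real m" by (intro mult_left_mono) auto
        then show "\<epsilon>\<^sup>2 * real (card K) \<le> 768" using m by (simp add: mult.commute)
      qed (rule J)
      also have "\<dots> \<le> (40 * ?r)\<^sup>2" using J by (simp add: power_mult_distrib r2)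
      finally have e2: "\<epsilon> * sqrt (real (card K) * J) \<le> 40 * ?r"
        by (rule power2_le_imp_le) (use r0 in simp)
      have "\<epsilon> * y \<omega> \<le> \<epsilon> * (sqrt (real (card K) * J) + 4)"
        using w \<epsilon> by (intro mult_left_mono) auto
      then show ?thesis using e1 e2 r0 unfolding distrib_left by linarith
    qed
    finally show ?thesis using N_ge \<epsilon> by (simp add: mult_ac mult_left_mono)
  qed
  show ?thesis
    unfolding y_def[symmetric] by (intro bexI[OF _ E] conjI p ballI good)
qed

end

section \<open>Minima of uniform hashes\<close>

text \<open>Strictness makes a winner in \<open>U\<close> unique and leaves none when the minimum is
  attained twice.\<close>

definition wins :: "(nat \<times> nat \<Rightarrow> real) \<Rightarrow> nat set \<Rightarrow> nat \<Rightarrow> nat \<Rightarrow> bool" where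
  "wins \<omega> U i j \<longleftrightarrow> (\<forall>l\<in>U - {j}. \<omega> (i, j) < \<omega> (i, l))"

text \<open>The transformation is increasing below 1 and turns a uniform variable into a standard
  exponential one, so this is at once a function of the least hash on \<open>U\<close> and a minimum
  of exponentials.\<close>

definition min_exp :: "(nat \<times> nat \<Rightarrow> real) \<Rightarrow> nat set \<Rightarrow> nat \<Rightarrow> real" where
  "min_exp \<omega> U i = Min ((\<lambda>j. - ln (1 - \<omega> (i, j))) ` U)"

lemma wins_unique:
  assumes "wins \<omega> U i j" "wins \<omega> U i l" "j \<in> U" "l \<in> U"
  shows "j = l"
proof (rule ccontr)
  assume "j \<noteq> l"
  then have "\<omega> (i, j) < \<omega> (i, l)" "\<omega> (i, l) < \<omega> (i, j)" using assms by (auto simp: wins_def)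
  then show False by simp
qed

lemma sum_wins:
  assumes "finite V" "V \<subseteq> U"
  shows "(\<Sum>j\<in>V. f j * of_bool (wins \<omega> U i j)) = (if \<exists>j\<in>V. wins \<omega> U i j then f (THE j. j \<in> V \<and> wins \<omega> U i j) else (0::real))"
proof (cases "\<exists>j\<in>V. wins \<omega> U i j")
  case True
  then obtain j where j: "j \<in> V" "wins \<omega> U i j" by blast
  then have u: "l \<in> V \<Longrightarrow> wins \<omega> U i l \<longleftrightarrow> l = j" for l using assms wins_unique by blast
  then have "(THE j. j \<in> V \<and> wins \<omega> U i j) = j" using j by blast
  moreover have "(\<Sum>l\<in>V. f l * of_bool (wins \<omega> U i l)) = (\<Sum>l\<in>V. if l = j then f j else 0)"
    by (rule sum.cong) (auto simp: u)
  ultimately show ?thesis using True j assms by simp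
qed simp

abbreviation "unif \<equiv> uniform_measure lborel {0..1::real}"

lemma prob_space_unif: "prob_space unif"
  by (rule prob_space_uniform_measure) auto

lemma prob_space_hash: "prob_space (hash_space m n)"
  unfolding hash_space_def by (intro prob_space_PiM prob_space_unif)

section \<open>Independence and regularity of the hash values\<close>

locale hashing =
  fixes m n :: nat
begin

sublocale prob_space "hash_space m n"
  by (rule prob_space_hash)

lemma coord_measurable:
  assumes "i < m" "j < n"
  shows "(\<lambda>\<omega>. \<omega> (i, j)) \<in> borel_measurable (hash_space m n)"
proof -
  have "(\<lambda>\<omega>. \<omega> (i, j)) \<in> hash_space m n \<rightarrow>\<^sub>M unif"
    unfolding hash_space_def by (rule measurable_component_singleton) (use assms in auto)
  then show ?thesis by (simp cong: measurable_cong_sets)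
qed

lemma distr_coord:
  assumes "i < m" "j < n"
  shows "distr (hash_space m n) borel (\<lambda>\<omega>. \<omega> (i, j)) = unif"
proof -
  have "distr (hash_space m n) borel (\<lambda>\<omega>. \<omega> (i, j)) = distr (hash_space m n) unif (\<lambda>\<omega>. \<omega> (i, j))"
    by (rule distr_cong) auto
  also have "\<dots> = unif"
    unfolding hash_space_def using assms by (intro distr_PiM_component prob_space_unif) auto
  finally show ?thesis .
qed

text \<open>Restriction to the index set changes no outcome, so the joint law of the coordinates is
  \<open>hash_space\<close> itself, which is the product of its marginals.\<close>

lemma indep_coords:
  assumes "m > 0" "n > 0"
  shows "indep_vars (\<lambda>_. borel) (\<lambda>x \<omega>. \<omega> x) ({..<m} \<times> {..<n})"
proof -
  let ?I = "{..<m} \<times> {..<n}"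
  have s: "sets (PiM ?I (\<lambda>_. borel)) = sets (hash_space m n)"
    unfolding hash_space_def by (intro sets_PiM_cong) auto
  have "distr (hash_space m n) (PiM ?I (\<lambda>_. borel)) (\<lambda>\<omega>. \<lambda>x\<in>?I. \<omega> x)
      = distr (hash_space m n) (PiM ?I (\<lambda>_. borel)) (\<lambda>\<omega>. \<omega>)"
    by (rule distr_cong) (auto simp: hash_space_def space_PiM intro: PiE_restrict)
  also have "\<dots> = hash_space m n" by (rule distr_id2[OF s])
  also have "\<dots> = PiM ?I (\<lambda>x. distr (hash_space m n) borel (\<lambda>\<omega>. \<omega> x))"
    unfolding hash_space_def[of m n] by (rule PiM_cong) (auto simp: distr_coord[unfolded hash_space_def])
  finally have eq: "distr (hash_space m n) (PiM ?I (\<lambda>_. borel)) (\<lambda>\<omega>. \<lambda>x\<in>?I. \<omega> x)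
      = PiM ?I (\<lambda>x. distr (hash_space m n) borel (\<lambda>\<omega>. \<omega> x))" .
  have "?I \<noteq> {}" using assms by auto
  then show ?thesis
    by (subst indep_vars_iff_distr_eq_PiM') (auto simp: eq intro: coord_measurable)
qed

lemma prob_coord:
  assumes "i < m" "j < n" "A \<in> sets borel"
  shows "prob {\<omega> \<in> space (hash_space m n). \<omega> (i, j) \<in> A} = measure lborel ({0..1} \<inter> A)"
proof -
  note [measurable] = coord_measurable[OF assms(1,2)]
  have "prob {\<omega> \<in> space (hash_space m n). \<omega> (i, j) \<in> A} = measure (distr (hash_space m n) borel (\<lambda>\<omega>. \<omega> (i, j))) A"
    by (subst measure_distr) (use assms in \<open>auto intro!: arg_cong[where f = prob]\<close>)
  also have "\<dots> = measure lborel ({0..1} \<inter> A)"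
    unfolding distr_coord[OF assms(1,2)] using assms by (subst measure_uniform_measure) auto
  finally show ?thesis .
qed

lemma exponential_coord:
  assumes i: "i < m" "j < n"
  shows "distributed (hash_space m n) lborel (\<lambda>\<omega>. - ln (1 - \<omega> (i, j))) (exponential_density 1)"
  unfolding exponential_distributed_iff[OF zero_less_one]
proof safe
  note [measurable] = coord_measurable[OF i]
  show "(\<lambda>\<omega>. - ln (1 - \<omega> (i, j))) \<in> borel_measurable (hash_space m n)" by measurable
  fix a :: real assume a: "0 \<le> a"
  let ?A = "{u :: real. - ln (1 - u) \<le> a}"
  have A: "?A \<in> sets borel" by measurable
  have "prob {\<omega> \<in> space (hash_space m n). - ln (1 - \<omega> (i, j)) \<le> a} = measure lborel ({0..1} \<inter> ?A)"
    using prob_coord[OF i A] by simp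
  \<comment> \<open>Since \<open>ln 0 = 0\<close>, the endpoint 1 satisfies the inequality as well;
    as a null set it is discarded in the next step.\<close>
  also have "{0..1} \<inter> ?A = insert 1 {0..1 - exp (- a)}"
  proof -
    have *: "- ln (1 - u) \<le> a \<longleftrightarrow> u \<le> 1 - exp (- a)" if "u < 1" for u :: real
    proof -
      have "- ln (1 - u) \<le> a \<longleftrightarrow> - a \<le> ln (1 - u)" by linarith
      also have "\<dots> \<longleftrightarrow> exp (- a) \<le> 1 - u" using that by (subst ln_ge_iff) auto
      finally show ?thesis by linarith
    qed
    show ?thesis
    proof (intro set_eqI)
      fix u :: real
      consider "u < 1" | "u = 1" | "u > 1" by linarith
      then show "u \<in> {0..1} \<inter> ?A \<longleftrightarrow> u \<in> insert 1 {0..1 - exp (- a)}"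
      proof cases
        case 3
        moreover have "1 - exp (- a) < u" using 3 exp_gt_zero[of "- a"] by linarith
        ultimately show ?thesis by auto
      qed (use a * in auto)
    qed
  qed
  also have "measure lborel (insert 1 {0..1 - exp (- a)}) = measure lborel {0..1 - exp (- a)}"
  proof (rule measure_eq_AE)
    show "AE u in lborel. u \<in> insert 1 {0..1 - exp (- a)} \<longleftrightarrow> u \<in> {0..1 - exp (- a)}"
      using AE_lborel_singleton[of "1::real"] by eventually_elim simp
  qed auto
  also have "\<dots> = 1 - exp (- a * 1)" using a by simp
  finally show "prob {\<omega> \<in> space (hash_space m n). - ln (1 - \<omega> (i, j)) \<le> a} = 1 - exp (- a * 1)" .
qed

text \<open>The outcomes on which sketches are decoded with certainty: ties would make equal hashes
  ambiguous, and at the value 1 the logarithm loses its monotonicity.\<close>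

definition regular :: "(nat \<times> nat \<Rightarrow> real) \<Rightarrow> bool" where
  "regular \<omega> \<longleftrightarrow> (\<forall>i\<in>{..<m}. \<forall>j\<in>{..<n}. 0 \<le> \<omega> (i, j) \<and> \<omega> (i, j) < 1 \<and> (\<forall>l\<in>{..<n}. l \<noteq> j \<longrightarrow> \<omega> (i, j) \<noteq> \<omega> (i, l)))"

lemma AE_regular: "AE \<omega> in hash_space m n. regular \<omega>"
proof -
  have 1: "AE \<omega> in hash_space m n. 0 \<le> \<omega> (i, j) \<and> \<omega> (i, j) < 1" if i: "i < m" "j < n" for i j
  proof -
    have "measure lborel ({0..1} \<inter> {0..<1::real}) = measure lborel {0..<1::real}"
      by (rule arg_cong[where f = "measure lborel"]) auto
    then have "prob {\<omega> \<in> space (hash_space m n). \<omega> (i, j) \<in> {0..<1}} = 1"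
      using prob_coord[OF i, of "{0..<1}"] by (simp del: Int_atLeastAtMost)
    from AE_prob_1[OF this] show ?thesis by eventually_elim auto
  qed
  have 2: "AE \<omega> in hash_space m n. \<omega> (i, j) \<noteq> \<omega> (i, l)" if i: "i < m" "j < n" "l < n" "l \<noteq> j" for i j l
  proof -
    note [measurable] = coord_measurable[OF i(1,2)] coord_measurable[OF i(1,3)]
    have "indep_var (PiM {(i, j)} (\<lambda>_. borel)) (\<lambda>\<omega>. \<lambda>x\<in>{(i, j)}. \<omega> x) (PiM {(i, l)} (\<lambda>_. borel)) (\<lambda>\<omega>. \<lambda>x\<in>{(i, l)}. \<omega> x)"
      by (rule indep_var_restrict[OF indep_coords]) (use i in auto)
    from indep_var_compose[OF this, of "\<lambda>r. r (i, j)" borel "\<lambda>r. r (i, l)" borel]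
    have ind: "indep_var borel (\<lambda>\<omega>. \<omega> (i, j)) borel (\<lambda>\<omega>. \<omega> (i, l))"
      by (simp add: comp_def)
    have "1 * prob {\<omega> \<in> space (hash_space m n). \<omega> (i, l) \<in> UNIV}
      \<le> prob {\<omega> \<in> space (hash_space m n). \<omega> (i, l) \<in> UNIV \<and> \<omega> (i, j) \<noteq> \<omega> (i, l)}"
    proof (rule prob_indep_fiberwise_ge[OF ind])
      show "{x \<in> space (borel \<Otimes>\<^sub>M borel). fst x \<noteq> snd x} \<in> sets (borel \<Otimes>\<^sub>M (borel :: real measure))" by measurable
      fix z :: real
      have "prob {\<omega> \<in> space (hash_space m n). \<omega> (i, j) \<in> - {z}} = measure lborel ({0..1} \<inter> - {z})"
        by (rule prob_coord[OF i(1,2)]) simp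
      also have "\<dots> = measure lborel {0..1::real}"
      proof (rule measure_eq_AE)
        show "AE u in lborel. u \<in> {0..1} \<inter> - {z} \<longleftrightarrow> u \<in> {0..1}"
          using AE_lborel_singleton[of z] by eventually_elim simp
      qed auto
      finally show "1 \<le> prob {\<omega> \<in> space (hash_space m n). \<omega> (i, j) \<noteq> z}" by simp
    qed simp
    then have "prob {\<omega> \<in> space (hash_space m n). \<omega> (i, j) \<noteq> \<omega> (i, l)} = 1"
      using prob_space by (intro antisym prob_le_1) simp
    from AE_prob_1[OF this] show ?thesis by eventually_elim auto
  qed
  have 3: "AE \<omega> in hash_space m n. l \<noteq> j \<longrightarrow> \<omega> (i, j) \<noteq> \<omega> (i, l)" if "i < m" "j < n" "l < n" for i j l
  proof (cases "l = j")
    case False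
    from 2[OF that False] show ?thesis by eventually_elim blast
  qed simp
  show ?thesis unfolding regular_def
  proof (intro AE_finite_allI)
    fix i j assume ij: "i \<in> {..<m}" "j \<in> {..<n}"
    have "AE \<omega> in hash_space m n. \<forall>l\<in>{..<n}. l \<noteq> j \<longrightarrow> \<omega> (i, j) \<noteq> \<omega> (i, l)"
    proof (rule AE_finite_allI)
      fix l assume "l \<in> {..<n}"
      with ij show "AE \<omega> in hash_space m n. l \<noteq> j \<longrightarrow> \<omega> (i, j) \<noteq> \<omega> (i, l)" by (intro 3) simp_all
    qed simp
    moreover have "AE \<omega> in hash_space m n. 0 \<le> \<omega> (i, j) \<and> \<omega> (i, j) < 1"
      by (rule 1) (use ij in auto)
    ultimately show "AE \<omega> in hash_space m n. 0 \<le> \<omega> (i, j) \<and> \<omega> (i, j) < 1 \<and>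
        (\<forall>l\<in>{..<n}. l \<noteq> j \<longrightarrow> \<omega> (i, j) \<noteq> \<omega> (i, l))"
      by eventually_elim blast
  qed auto
qed

end

section \<open>The law of the winner and of the minimum\<close>

text \<open>The measure space is arbitrary because the lemma is applied both to
  \<open>hash_space\<close> and to the product over the coordinates of a single hash
  function.\<close>

lemma pred_wins:
  assumes "finite U" and "\<And>l. l \<in> insert j U \<Longrightarrow> (\<lambda>\<omega>. \<omega> (i, l)) \<in> borel_measurable M"
  shows "Measurable.pred M (\<lambda>\<omega>. wins \<omega> U i j)"
  unfolding wins_def
proof (rule pred_intros_finite(3))
  fix l assume "l \<in> U - {j}"
  then have [measurable]: "(\<lambda>\<omega>. \<omega> (i, l)) \<in> borel_measurable M" "(\<lambda>\<omega>. \<omega> (i, j)) \<in> borel_measurable M"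
    using assms by auto
  show "Measurable.pred M (\<lambda>\<omega>. \<omega> (i, j) < \<omega> (i, l))" by measurable
qed (use assms in simp)

lemma borel_measurable_min_exp:
  assumes "finite U" and "\<And>l. l \<in> U \<Longrightarrow> (\<lambda>\<omega>. \<omega> (i, l)) \<in> borel_measurable M"
  shows "(\<lambda>\<omega>. min_exp \<omega> U i) \<in> borel_measurable M"
  unfolding min_exp_def
proof (rule borel_measurable_Min)
  fix l assume "l \<in> U"
  then have [measurable]: "(\<lambda>\<omega>. \<omega> (i, l)) \<in> borel_measurable M" using assms by simp
  show "(\<lambda>\<omega>. - ln (1 - \<omega> (i, l))) \<in> borel_measurable M" by measurable
qed (use assms in simp)

text \<open>The weight of the winner of \<open>U\<close> if it lies in \<open>V\<close>, and 0
  otherwise; for constant weight 1, the indicator of a winner in \<open>V\<close>. As a sum over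
  events it has its mean by linearity.\<close>

definition winner_weight :: "(nat \<Rightarrow> real) \<Rightarrow> nat set \<Rightarrow> nat set \<Rightarrow> nat \<Rightarrow> (nat \<times> nat \<Rightarrow> real) \<Rightarrow> real" where
  "winner_weight p V U i \<omega> = (\<Sum>j\<in>V. p j * of_bool (wins \<omega> U i j))"

lemma borel_measurable_winner_weight:
  assumes "finite U" "V \<subseteq> U" and "\<And>l. l \<in> U \<Longrightarrow> (\<lambda>\<omega>. \<omega> (i, l)) \<in> borel_measurable M"
  shows "winner_weight p V U i \<in> borel_measurable M"
proof -
  have "(\<lambda>\<omega>. p j * of_bool (wins \<omega> U i j)) \<in> borel_measurable M" if "j \<in> V" for j
  proof -
    have [measurable]: "Measurable.pred M (\<lambda>\<omega>. wins \<omega> U i j)"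
      using assms that by (intro pred_wins) auto
    show ?thesis by measurable
  qed
  then show ?thesis unfolding winner_weight_def[abs_def] by (rule borel_measurable_sum)
qed

context hashing
begin

lemma regular_wins:
  assumes "regular \<omega>" "i < m" "U \<subseteq> {..<n}" "U \<noteq> {}"
  shows "arg_min_on (\<lambda>j. \<omega> (i, j)) U \<in> U" "wins \<omega> U i (arg_min_on (\<lambda>j. \<omega> (i, j)) U)"
proof -
  let ?j = "arg_min_on (\<lambda>j. \<omega> (i, j)) U"
  have fin: "finite U" using assms finite_subset by blast
  note am = arg_min_if_finite[OF fin assms(4), of "\<lambda>j. \<omega> (i, j)"]
  have "\<omega> (i, ?j) < \<omega> (i, l)" if "l \<in> U - {?j}" for l
  proof -
    have "\<not> \<omega> (i, l) < \<omega> (i, ?j)" using am that by blast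
    moreover have "\<omega> (i, ?j) \<noteq> \<omega> (i, l)"
      using assms(1-3) am(1) that unfolding regular_def by blast
    ultimately show ?thesis by linarith
  qed
  then show "wins \<omega> U i ?j" by (simp add: wins_def)
  show "?j \<in> U" by (rule am(1))
qed

lemma wins_event:
  assumes "i < m" "U \<subseteq> {..<n}" "j \<in> U"
  shows "{\<omega> \<in> space (hash_space m n). wins \<omega> U i j} \<in> events"
proof -
  have "Measurable.pred (hash_space m n) (\<lambda>\<omega>. wins \<omega> U i j)"
    by (rule pred_wins) (use assms finite_subset[OF assms(2)] in \<open>auto intro!: coord_measurable\<close>)
  then show ?thesis by (simp add: pred_def)
qed

text \<open>Exchanging the coordinates \<open>j\<close> and \<open>l\<close> in every hash function
  preserves the product measure and carries one event to the other.\<close>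

lemma prob_wins_swap:
  assumes i: "i < m" and U: "U \<subseteq> {..<n}" and j: "j \<in> U" and l: "l \<in> U"
  shows "prob {\<omega> \<in> space (hash_space m n). wins \<omega> U i j} = prob {\<omega> \<in> space (hash_space m n). wins \<omega> U i l}"
proof -
  let ?I = "{..<m} \<times> {..<n}"
  define \<sigma> where "\<sigma> x = (if x = j then l else if x = l then j else x)" for x
  define f where "f x = (fst x, \<sigma> (snd x))" for x :: "nat \<times> nat"
  have \<sigma>\<sigma>: "\<sigma> (\<sigma> x) = x" for x by (simp add: \<sigma>_def)
  have \<sigma>j: "\<sigma> j = l" by (simp add: \<sigma>_def)
  have \<sigma>U: "\<sigma> x \<in> U \<longleftrightarrow> x \<in> U" for x using j l by (auto simp: \<sigma>_def)
  have \<sigma>n: "\<sigma> x < n \<longleftrightarrow> x < n" for x using j l U by (auto simp: \<sigma>_def)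
  have inj: "inj_on f ?I" by (rule inj_on_inverseI[of _ f]) (simp add: f_def \<sigma>\<sigma>)
  have fI: "f \<in> ?I \<rightarrow> ?I" by (auto simp: f_def \<sigma>n)
  let ?t = "\<lambda>\<omega>. \<lambda>x\<in>?I. \<omega> (f x)"
  have distr: "distr (hash_space m n) (hash_space m n) ?t = hash_space m n"
    unfolding hash_space_def by (rule distr_PiM_reindex[OF prob_space_unif inj fI])
  have meas: "?t \<in> hash_space m n \<rightarrow>\<^sub>M hash_space m n"
    unfolding hash_space_def
    by (rule measurable_restrict, rule measurable_component_singleton) (use fI in auto)
  have wins: "wins (?t \<omega>) U i j \<longleftrightarrow> wins \<omega> U i l" for \<omega>
  proof -
    have "wins (?t \<omega>) U i j \<longleftrightarrow> (\<forall>x\<in>U - {j}. \<omega> (i, \<sigma> j) < \<omega> (i, \<sigma> x))"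
      unfolding wins_def by (rule ball_cong) (use i U j in \<open>auto simp: f_def\<close>)
    also have "\<dots> \<longleftrightarrow> (\<forall>y\<in>\<sigma> ` (U - {j}). \<omega> (i, l) < \<omega> (i, y))"
      unfolding \<sigma>j by blast
    also have "\<sigma> ` (U - {j}) = U - {l}"
    proof (intro set_eqI iffI)
      fix y assume "y \<in> U - {l}"
      then have "\<sigma> y \<in> U - {j}" using \<sigma>U by (auto simp: \<sigma>_def)
      then show "y \<in> \<sigma> ` (U - {j})" by (intro image_eqI[of y \<sigma> "\<sigma> y"] \<sigma>\<sigma>[symmetric])
    next
      fix y assume "y \<in> \<sigma> ` (U - {j})"
      then obtain x where x: "x \<in> U" "x \<noteq> j" "y = \<sigma> x" by blast
      then have "y \<in> U" using \<sigma>U by blast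
      moreover have "y \<noteq> l" using x by (auto simp: \<sigma>_def split: if_splits)
      ultimately show "y \<in> U - {l}" by blast
    qed
    finally show ?thesis by (simp add: wins_def)
  qed
  have "prob {\<omega> \<in> space (hash_space m n). wins \<omega> U i j}
      = measure (distr (hash_space m n) (hash_space m n) ?t) {\<omega> \<in> space (hash_space m n). wins \<omega> U i j}"
    unfolding distr ..
  also have "\<dots> = prob (?t -` {\<omega> \<in> space (hash_space m n). wins \<omega> U i j} \<inter> space (hash_space m n))"
    by (rule measure_distr[OF meas wins_event[OF i U j]])
  also have "?t -` {\<omega> \<in> space (hash_space m n). wins \<omega> U i j} \<inter> space (hash_space m n)
      = {\<omega> \<in> space (hash_space m n). wins \<omega> U i l}"
    using measurable_space[OF meas] wins by blast
  finally show ?thesis .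
qed

text \<open>By symmetry all elements of \<open>U\<close> win with equal probability, and these
  events are disjoint and cover all regular outcomes.\<close>

lemma prob_wins:
  assumes i: "i < m" and U: "U \<subseteq> {..<n}" and j: "j \<in> U"
  shows "prob {\<omega> \<in> space (hash_space m n). wins \<omega> U i j} = 1 / real (card U)"
proof -
  let ?W = "\<lambda>l. {\<omega> \<in> space (hash_space m n). wins \<omega> U i l}"
  have fin: "finite U" using U finite_subset by blast
  have "prob (\<Union>l\<in>U. ?W l) = 1"
  proof (rule antisym[OF prob_le_1])
    have ev: "(\<Union>l\<in>U. ?W l) \<in> events" using fin wins_event[OF i U] by blast
    have "AE \<omega> in hash_space m n. \<omega> \<in> (\<Union>l\<in>U. ?W l)"
      using AE_regular AE_space
    proof eventually_elim
      case (elim \<omega>)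
      then show ?case using regular_wins[OF elim(1) i U] j by blast
    qed
    then show "1 \<le> prob (\<Union>l\<in>U. ?W l)" using prob_eq_1[OF ev] by simp
  qed
  also have "prob (\<Union>l\<in>U. ?W l) = (\<Sum>l\<in>U. prob (?W l))"
  proof (rule finite_measure_finite_Union[OF fin])
    show "?W ` U \<subseteq> events" using wins_event[OF i U] by blast
    show "disjoint_family_on ?W U" unfolding disjoint_family_on_def using wins_unique by blast
  qed
  also have "\<dots> = (\<Sum>l\<in>U. prob (?W j))"
    by (rule sum.cong[OF refl]) (rule prob_wins_swap[OF i U _ j])
  finally have "real (card U) * prob (?W j) = 1" by simp
  moreover have "real (card U) \<noteq> 0" using fin j by auto
  ultimately show ?thesis
    by (subst eq_divide_eq) (simp add: mult.commute)
qed

end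

context hashing
begin

text \<open>The minimum of independent exponential variables is exponential with the sum of their
  rates, here \<open>card U\<close> rates equal to 1.\<close>

lemma exponential_min_exp:
  assumes i: "i < m" and U: "U \<subseteq> {..<n}" "U \<noteq> {}"
  shows "distributed (hash_space m n) lborel (\<lambda>\<omega>. min_exp \<omega> U i) (exponential_density (real (card U)))"
proof -
  have fin: "finite U" using U finite_subset by blast
  have pos: "m > 0" "n > 0" using i U by auto
  have "indep_vars (\<lambda>_. borel) (\<lambda>j \<omega>. - ln (1 - (\<lambda>x\<in>{(i, j)}. \<omega> x) (i, j))) U"
    by (rule indep_vars_compose2[OF indep_vars_restrict[OF indep_coords[OF pos]], of U "\<lambda>j. {(i, j)}"])
      (use i U in \<open>auto simp: disjoint_family_on_def\<close>)
  then have "indep_vars (\<lambda>_. borel) (\<lambda>j \<omega>. - ln (1 - \<omega> (i, j))) U" by simp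
  then have "distributed (hash_space m n) lborel (\<lambda>\<omega>. Min ((\<lambda>j. - ln (1 - \<omega> (i, j))) ` U))
      (exponential_density (\<Sum>j\<in>U. 1))"
    by (intro exponential_distributed_Min fin U exponential_coord i) (use U in auto)
  then show ?thesis by (simp add: min_exp_def)
qed

lemma expectation_winner_weight:
  assumes i: "i < m" and U: "U \<subseteq> {..<n}" and V: "V \<subseteq> U"
  shows "expectation (winner_weight p V U i) = (\<Sum>j\<in>V. p j) / real (card U)"
proof -
  let ?W = "\<lambda>j. {\<omega> \<in> space (hash_space m n). wins \<omega> U i j}"
  have ev: "?W j \<in> events" if "j \<in> V" for j using wins_event[OF i U] V that by blast
  have "expectation (winner_weight p V U i) = expectation (\<lambda>\<omega>. \<Sum>j\<in>V. p j * indicator (?W j) \<omega>)"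
    unfolding winner_weight_def[abs_def]
    by (rule Bochner_Integration.integral_cong) (auto simp: indicator_def intro!: sum.cong)
  also have "\<dots> = (\<Sum>j\<in>V. expectation (\<lambda>\<omega>. p j * indicator (?W j) \<omega>))"
    by (rule Bochner_Integration.integral_sum)
      (use ev in \<open>auto intro!: integrable_mult_right simp: integrable_indicator_iff emeasure_eq_measure\<close>)
  also have "\<dots> = (\<Sum>j\<in>V. p j * (1 / real (card U)))"
  proof (rule sum.cong[OF refl])
    fix j assume j: "j \<in> V"
    then have "j \<in> U" using V by blast
    have "expectation (\<lambda>\<omega>. p j * indicator (?W j) \<omega>) = p j * prob (?W j \<inter> space (hash_space m n))"
      by (simp only: integral_mult_right_zero Bochner_Integration.integral_indicator)
    also have "?W j \<inter> space (hash_space m n) = ?W j" by blast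
    finally show "expectation (\<lambda>\<omega>. p j * indicator (?W j) \<omega>) = p j * (1 / real (card U))"
      unfolding prob_wins[OF i U \<open>j \<in> U\<close>] .
  qed
  finally show ?thesis by (simp add: sum_divide_distrib)
qed

lemma winner_weight_cases:
  assumes "finite U" "V \<subseteq> U" "\<And>j. j \<in> V \<Longrightarrow> \<bar>p j\<bar> \<le> 1"
  shows "winner_weight (\<lambda>_. 1) V U i \<omega> = 0 \<or> winner_weight (\<lambda>_. 1) V U i \<omega> = 1"
    and "\<bar>winner_weight p V U i \<omega>\<bar> \<le> winner_weight (\<lambda>_. 1) V U i \<omega>"
proof -
  have fin: "finite V" using assms finite_subset by blast
  show "winner_weight (\<lambda>_. 1) V U i \<omega> = 0 \<or> winner_weight (\<lambda>_. 1) V U i \<omega> = 1"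
    unfolding winner_weight_def sum_wins[OF fin assms(2)] by simp
  have "\<bar>winner_weight p V U i \<omega>\<bar> \<le> (\<Sum>j\<in>V. \<bar>p j * of_bool (wins \<omega> U i j)\<bar>)"
    unfolding winner_weight_def by (rule sum_abs)
  also have "\<dots> \<le> winner_weight (\<lambda>_. 1) V U i \<omega>"
    unfolding winner_weight_def by (rule sum_mono) (use assms(3) in auto)
  finally show "\<bar>winner_weight p V U i \<omega>\<bar> \<le> winner_weight (\<lambda>_. 1) V U i \<omega>" .
qed

lemma exp_samples_hash:
  assumes m: "0 < m" and U: "U \<subseteq> {..<n}" "U \<noteq> {}" and V: "V \<subseteq> U" and p: "\<And>j. j \<in> V \<Longrightarrow> \<bar>p j\<bar> \<le> 1"
  shows "exp_samples (hash_space m n) m (winner_weight p V U) (winner_weight (\<lambda>_. 1) V U)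
    (\<lambda>i \<omega>. min_exp \<omega> U i) (real (card U)) (real (card V) / real (card U)) (\<Sum>j\<in>V. p j)"
proof -
  have fin: "finite U" using U finite_subset by blast
  have finV: "finite V" using V fin finite_subset by blast
  have cU: "real (card U) > 0" using fin U by (simp add: card_gt_0_iff)
  show ?thesis
  proof unfold_locales
    let ?B = "borel \<Otimes>\<^sub>M borel \<Otimes>\<^sub>M borel :: (real \<times> real \<times> real) measure"
    show "indep_vars (\<lambda>_. ?B)
      (\<lambda>i \<omega>. (winner_weight p V U i \<omega>, winner_weight (\<lambda>_. 1) V U i \<omega>, min_exp \<omega> U i)) {..<m}"
    proof -
      have pos: "m > 0" "n > 0" using m U by auto
      let ?K = "\<lambda>i. {i} \<times> {..<n}"
      let ?f = "\<lambda>i r. (winner_weight p V U i r, winner_weight (\<lambda>_. 1) V U i r, min_exp r U i)"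
      \<comment> \<open>The triple of sample \<open>i\<close> reads only the coordinates of hash
        function \<open>i\<close>, so restricting the outcome to them changes nothing. These blocks
        are disjoint for different \<open>i\<close>, which yields independence.\<close>
      have restr: "?f i (\<lambda>x\<in>?K i. \<omega> x) = ?f i \<omega>" for i and \<omega> :: "nat \<times> nat \<Rightarrow> real"
      proof -
        have e: "(\<lambda>x\<in>?K i. \<omega> x) (i, j) = \<omega> (i, j)" if "j \<in> U" for j using that U by auto
        have "wins (\<lambda>x\<in>?K i. \<omega> x) U i j = wins \<omega> U i j" if "j \<in> V" for j
          unfolding wins_def by (rule ball_cong[OF refl]) (use e V that in \<open>simp only: DiffD1 subsetD\<close>)
        then have "winner_weight q V U i (\<lambda>x\<in>?K i. \<omega> x) = winner_weight q V U i \<omega>" for q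
          unfolding winner_weight_def by (intro sum.cong) simp_all
        moreover have "min_exp (\<lambda>x\<in>?K i. \<omega> x) U i = min_exp \<omega> U i"
          unfolding min_exp_def by (rule arg_cong[where f = Min], rule image_cong) (simp_all only: e)
        ultimately show ?thesis by (simp only:)
      qed
      have "indep_vars (\<lambda>_. ?B) (\<lambda>i \<omega>. ?f i (\<lambda>x\<in>?K i. \<omega> x)) {..<m}"
      proof (rule indep_vars_compose2[OF indep_vars_restrict[OF indep_coords[OF pos]]])
        show "disjoint_family_on ?K {..<m}" by (auto simp: disjoint_family_on_def)
        fix i assume i: "i \<in> {..<m}"
        then show "?K i \<subseteq> {..<m} \<times> {..<n}" by auto
        have c: "(\<lambda>r. r (i, l)) \<in> borel_measurable (PiM (?K i) (\<lambda>_. borel))" if "l \<in> U" for l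
          by (rule measurable_component_singleton) (use that U in auto)
        have [measurable]: "winner_weight q V U i \<in> borel_measurable (PiM (?K i) (\<lambda>_. borel))" for q
          by (rule borel_measurable_winner_weight[OF fin V c])
        have [measurable]: "(\<lambda>r. min_exp r U i) \<in> borel_measurable (PiM (?K i) (\<lambda>_. borel))"
          by (rule borel_measurable_min_exp[OF fin c])
        show "?f i \<in> PiM (?K i) (\<lambda>_. borel) \<rightarrow>\<^sub>M ?B" by measurable
      qed
      then show ?thesis unfolding restr .
    qed
    show "real (card U) > 0" by (rule cU)
    show "0 \<le> real (card V) / real (card U)" by simp
    show "real (card V) / real (card U) \<le> 1"
      using card_mono[OF fin V] cU by simp
    have "\<bar>\<Sum>j\<in>V. p j\<bar> \<le> (\<Sum>j\<in>V. \<bar>p j\<bar>)" by (rule sum_abs)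
    also have "\<dots> \<le> real (card V)" using sum_bounded_above[of V "\<lambda>j. \<bar>p j\<bar>" 1] p by simp
    finally show "\<bar>\<Sum>j\<in>V. p j\<bar> \<le> real (card U) * (real (card V) / real (card U))"
      using cU by simp
    fix i assume i: "i < m"
    show "distributed (hash_space m n) lborel (\<lambda>\<omega>. min_exp \<omega> U i) (exponential_density (real (card U)))"
      by (rule exponential_min_exp[OF i U])
    show "expectation (winner_weight p V U i) = (\<Sum>j\<in>V. p j) / real (card U)"
      by (rule expectation_winner_weight[OF i U(1) V])
    show "expectation (winner_weight (\<lambda>_. 1) V U i) = real (card V) / real (card U)"
      using expectation_winner_weight[OF i U(1) V, of "\<lambda>_. 1"] by simp
    fix \<omega>
    show "\<bar>winner_weight p V U i \<omega>\<bar> \<le> winner_weight (\<lambda>_. 1) V U i \<omega>"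
      "winner_weight (\<lambda>_. 1) V U i \<omega> = 0 \<or> winner_weight (\<lambda>_. 1) V U i \<omega> = 1"
      using winner_weight_cases[OF fin V p] by auto
  qed
qed

end

section \<open>Estimation from sketches\<close>

lemma med_cong:
  assumes "\<And>l. l < g \<Longrightarrow> x l = y l"
  shows "med g x = med g y"
proof -
  have "{j. j < g \<and> x j \<le> x i} = {j. j < g \<and> y j \<le> y i}" if "i < g" for i
    using assms that by auto
  then have "{i. i < g \<and> g \<le> 2 * card {j. j < g \<and> x j \<le> x i}} = {i. i < g \<and> g \<le> 2 * card {j. j < g \<and> y j \<le> y i}}"
    by (intro Collect_cong conj_cong) simp_all
  then show ?thesis
    unfolding med_def by (intro arg_cong[where f = Min] image_cong) (use assms in auto)
qed

text \<open>Equality of the stored hashes is the observable form of equality of the two minimisers;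
  on regular outcomes they are equivalent.\<close>

definition hit :: "(real \<times> real) list \<Rightarrow> (real \<times> real) list \<Rightarrow> nat \<Rightarrow> real" where
  "hit xs ys i = of_bool (fst (xs ! i) = fst (ys ! i))"

definition hit_prod :: "real \<Rightarrow> (real \<times> real) list \<Rightarrow> (real \<times> real) list \<Rightarrow> nat \<Rightarrow> real" where
  "hit_prod c xs ys i = hit xs ys i * (snd (xs ! i) * snd (ys ! i) / c\<^sup>2)"

definition merged_exp :: "(real \<times> real) list \<Rightarrow> (real \<times> real) list \<Rightarrow> nat \<Rightarrow> real" where
  "merged_exp xs ys i = - ln (1 - min (fst (xs ! i)) (fst (ys ! i)))"

lemma supp_subset: "supp n a \<subseteq> {..<n}" "finite (supp n a)"
  by (auto simp: supp_def)

lemma winner_weight_eq: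
  assumes "finite U" "V \<subseteq> U" "j \<in> V" "wins \<omega> U i j"
  shows "winner_weight p V U i \<omega> = p j"
proof -
  have fin: "finite V" using assms finite_subset by blast
  have "(THE l. l \<in> V \<and> wins \<omega> U i l) = j"
    using assms wins_unique[of \<omega> U i] by blast
  then show ?thesis
    unfolding winner_weight_def sum_wins[OF fin assms(2)] using assms(3,4) by auto
qed

context hashing
begin

lemma sketch_nth:
  assumes "i < m" "supp n a \<noteq> {}" and "j = arg_min_on (\<lambda>j. \<omega> (i, j)) (supp n a)"
  shows "minhash_sketch m n \<omega> a ! i = (\<omega> (i, j), a j)"
  using assms by (simp add: minhash_sketch_def Let_def)

text \<open>If the two minimisers coincide, their common index lies in \<open>V\<close> and wins on
  \<open>U\<close>. If they differ, nothing in \<open>V\<close> wins on \<open>U\<close>, since such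
  an element would win on both supports and so equal both minimisers. The least hash on
  \<open>U\<close> is the smaller of the two stored ones.\<close>

lemma sketch_decode:
  assumes reg: "regular \<omega>" and i: "i < m" and A: "supp n a \<noteq> {}" and B: "supp n b \<noteq> {}"
  defines "U \<equiv> supp n a \<union> supp n b" and "V \<equiv> supp n a \<inter> supp n b"
    and "xs \<equiv> minhash_sketch m n \<omega> a" and "ys \<equiv> minhash_sketch m n \<omega> b"
  shows "hit xs ys i = winner_weight (\<lambda>_. 1) V U i \<omega>"
    and "hit_prod c xs ys i = winner_weight (\<lambda>j. a j * b j / c\<^sup>2) V U i \<omega>"
    and "merged_exp xs ys i = min_exp \<omega> U i"
    and "snd (xs ! i) \<noteq> 0" "snd (ys ! i) \<noteq> 0"
proof -
  define j where "j = arg_min_on (\<lambda>j. \<omega> (i, j)) (supp n a)"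
  define l where "l = arg_min_on (\<lambda>j. \<omega> (i, j)) (supp n b)"
  have xs: "xs ! i = (\<omega> (i, j), a j)" and ys: "ys ! i = (\<omega> (i, l), b l)"
    unfolding xs_def ys_def by (rule sketch_nth[OF i A j_def], rule sketch_nth[OF i B l_def])
  have j: "j \<in> supp n a" "wins \<omega> (supp n a) i j"
    unfolding j_def by (rule regular_wins[OF reg i supp_subset(1) A])+
  have l: "l \<in> supp n b" "wins \<omega> (supp n b) i l"
    unfolding l_def by (rule regular_wins[OF reg i supp_subset(1) B])+
  have jn: "j < n" "l < n" using j(1) l(1) by (auto simp: supp_def)
  have U: "finite U" "V \<subseteq> U" by (auto simp: U_def V_def supp_subset)
  show "snd (xs ! i) \<noteq> 0" "snd (ys ! i) \<noteq> 0"
    using j(1) l(1) by (auto simp: xs ys supp_def)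
  have inj: "\<omega> (i, j) = \<omega> (i, l) \<longleftrightarrow> j = l"
  proof (cases "j = l")
    case False
    have "\<forall>l\<in>{..<n}. l \<noteq> j \<longrightarrow> \<omega> (i, j) \<noteq> \<omega> (i, l)"
      using reg i jn(1) by (simp add: regular_def)
    with False jn(2) show ?thesis by simp
  qed simp
  \<comment> \<open>A generic \<open>f\<close> treats \<open>hit\<close> and \<open>hit_prod\<close>
    at once; only its diagonal matters, because \<open>hit\<close> vanishes for distinct
    minimisers.\<close>
  have "hit xs ys i * f j l = winner_weight p V U i \<omega>" if f: "f j j = p j" for f :: "nat \<Rightarrow> nat \<Rightarrow> real" and p
  proof (cases "j = l")
    case True
    have "j \<in> V" using j(1) l(1) True by (simp add: V_def)
    moreover have "wins \<omega> U i j"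
      using j(2) l(2)[folded True] unfolding U_def wins_def by blast
    ultimately have "winner_weight p V U i \<omega> = p j" by (rule winner_weight_eq[OF U])
    then show ?thesis using True f by (simp add: hit_def xs ys)
  next
    case False
    have "\<not> wins \<omega> U i x" if x: "x \<in> V" for x
    proof
      assume w: "wins \<omega> U i x"
      then have "wins \<omega> (supp n a) i x" "wins \<omega> (supp n b) i x" by (auto simp: U_def wins_def)
      moreover have "x \<in> supp n a" "x \<in> supp n b" using x by (auto simp: V_def)
      ultimately have "x = j" "x = l"
        using wins_unique[OF _ j(2) _ j(1)] wins_unique[OF _ l(2) _ l(1)] by blast+
      with False show False by simp
    qed
    then have "winner_weight p V U i \<omega> = 0" unfolding winner_weight_def by (intro sum.neutral) simp
    then show ?thesis using False inj by (simp add: hit_def xs ys)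
  qed
  from this[of "\<lambda>_ _. 1" "\<lambda>_. 1"] this[of "\<lambda>j l. a j * b l / c\<^sup>2" "\<lambda>j. a j * b j / c\<^sup>2"]
  show "hit xs ys i = winner_weight (\<lambda>_. 1) V U i \<omega>"
    "hit_prod c xs ys i = winner_weight (\<lambda>j. a j * b j / c\<^sup>2) V U i \<omega>"
    by (simp_all add: hit_prod_def xs ys)
  define t where "t = min (\<omega> (i, j)) (\<omega> (i, l))"
  have le: "t \<le> \<omega> (i, x)" "\<omega> (i, x) < 1" if "x \<in> U" for x
  proof -
    have "\<omega> (i, j) \<le> \<omega> (i, x) \<or> \<omega> (i, l) \<le> \<omega> (i, x)"
    proof -
      from that consider "x = j" | "x = l" | "x \<in> supp n a - {j}" | "x \<in> supp n b - {l}"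
        unfolding U_def by blast
      then show ?thesis
        using bspec[OF j(2)[unfolded wins_def], of x] bspec[OF l(2)[unfolded wins_def], of x]
        by cases auto
    qed
    then show "t \<le> \<omega> (i, x)" by (auto simp: t_def)
    have "x < n" using that by (auto simp: U_def supp_def)
    then show "\<omega> (i, x) < 1" using reg i by (simp add: regular_def)
  qed
  have "min_exp \<omega> U i = - ln (1 - t)"
    unfolding min_exp_def
  proof (rule Min_eqI)
    show "finite ((\<lambda>j. - ln (1 - \<omega> (i, j))) ` U)" using U by simp
    show "- ln (1 - t) \<in> (\<lambda>j. - ln (1 - \<omega> (i, j))) ` U"
    proof -
      have "t = \<omega> (i, j) \<or> t = \<omega> (i, l)" by (simp add: t_def min_def)
      moreover have "j \<in> U" "l \<in> U" using j(1) l(1) by (simp_all add: U_def)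
      ultimately obtain x where "x \<in> U" "t = \<omega> (i, x)" by blast
      then show ?thesis by (intro image_eqI[of _ _ x]) simp_all
    qed
    fix z assume "z \<in> (\<lambda>j. - ln (1 - \<omega> (i, j))) ` U"
    then obtain x where x: "x \<in> U" "z = - ln (1 - \<omega> (i, x))" by blast
    have "ln (1 - \<omega> (i, x)) \<le> ln (1 - t)"
      using le[OF x(1)] by (intro ln_mono) auto
    then show "- ln (1 - t) \<le> z" using x by simp
  qed
  then show "merged_exp xs ys i = min_exp \<omega> U i"
    by (simp add: merged_exp_def xs ys t_def)
qed

text \<open>Reduces the theorem to the choice of a function \<open>G\<close> of the samples. By
  \<open>cong\<close>, \<open>G\<close> reads only the first \<open>m\<close> entries, where the
  decoded sketches agree with the true samples on regular outcomes.\<close>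

lemma estimator_from_samples:
  fixes G :: "(nat \<Rightarrow> real) \<Rightarrow> (nat \<Rightarrow> real) \<Rightarrow> (nat \<Rightarrow> real) \<Rightarrow> real"
  assumes m: "0 < m" and c: "0 < c" and \<epsilon>: "0 < \<epsilon>" and q: "q \<le> 1"
    and cong: "\<And>X X' Q Q' Y Y'. (\<And>i. i < m \<Longrightarrow> X i = X' i) \<Longrightarrow> (\<And>i. i < m \<Longrightarrow> Q i = Q' i) \<Longrightarrow>
      (\<And>i. i < m \<Longrightarrow> Y i = Y' i) \<Longrightarrow> G X Q Y = G X' Q' Y'"
    and good: "\<And>p U V. U \<subseteq> {..<n} \<Longrightarrow> U \<noteq> {} \<Longrightarrow> V \<subseteq> U \<Longrightarrow> (\<And>j. j \<in> V \<Longrightarrow> \<bar>p j\<bar> \<le> 1) \<Longrightarrow>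
      \<exists>E\<in>events. prob E \<ge> q \<and> (\<forall>\<omega>\<in>E.
        \<bar>G (\<lambda>i. winner_weight p V U i \<omega>) (\<lambda>i. winner_weight (\<lambda>_. 1) V U i \<omega>) (\<lambda>i. min_exp \<omega> U i) - (\<Sum>j\<in>V. p j)\<bar>
          \<le> \<epsilon> * real (card U) * sqrt (real (card V) / real (card U) / 2))"
  shows "\<exists>F :: (real \<times> real) list \<Rightarrow> (real \<times> real) list \<Rightarrow> real.
      \<forall>a b :: nat \<Rightarrow> real.
        (\<forall>i<n. \<bar>a i\<bar> \<le> c \<and> \<bar>b i\<bar> \<le> c) \<longrightarrow>
        (\<exists>E \<in> sets (hash_space m n).
           measure (hash_space m n) E \<ge> q \<and>
           (\<forall>\<omega> \<in> E.
              \<bar>F (minhash_sketch m n \<omega> a) (minhash_sketch m n \<omega> b) - inner_prod n a b\<bar>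
              \<le> \<epsilon> * c\<^sup>2 * sqrt (real (max (card (supp n a)) (card (supp n b)))
                                  * real (card (supp n a \<inter> supp n b)))))"
proof (intro exI allI impI)
  \<comment> \<open>A zero value in entry 0 reveals the sentinel of the zero vector, for which 0 is
    the exact answer. The samples carry products divided by the square of \<open>c\<close>, which is
    restored here.\<close>
  let ?F = "\<lambda>xs ys. if snd (xs ! 0) = 0 \<or> snd (ys ! 0) = 0 then 0
    else c\<^sup>2 * G (hit_prod c xs ys) (hit xs ys) (merged_exp xs ys)"
  fix a b :: "nat \<Rightarrow> real"
  assume ab: "\<forall>i<n. \<bar>a i\<bar> \<le> c \<and> \<bar>b i\<bar> \<le> c"
  let ?A = "supp n a" and ?B = "supp n b"
  let ?bound = "\<epsilon> * c\<^sup>2 * sqrt (real (max (card ?A) (card ?B)) * real (card (?A \<inter> ?B)))"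
  have c2: "c\<^sup>2 > 0" using c by simp
  let ?p = "\<lambda>j. a j * b j / c\<^sup>2"
  have inner: "inner_prod n a b = c\<^sup>2 * (\<Sum>j\<in>?A \<inter> ?B. ?p j)"
  proof -
    have "inner_prod n a b = (\<Sum>j\<in>?A \<inter> ?B. a j * b j)"
      unfolding inner_prod_def by (rule sum.mono_neutral_right) (auto simp: supp_def)
    then show ?thesis using c by (simp add: sum_distrib_left)
  qed
  have bound0: "0 \<le> ?bound" using \<epsilon> by simp
  show "\<exists>E \<in> sets (hash_space m n). q \<le> measure (hash_space m n) E \<and>
    (\<forall>\<omega>\<in>E. \<bar>?F (minhash_sketch m n \<omega> a) (minhash_sketch m n \<omega> b) - inner_prod n a b\<bar> \<le> ?bound)"
  proof (cases "?A = {} \<or> ?B = {}")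
    case True
    then have F: "?F (minhash_sketch m n \<omega> a) (minhash_sketch m n \<omega> b) = 0" for \<omega>
      using m by (auto simp: minhash_sketch_def)
    have "inner_prod n a b = 0" using inner True by auto
    then show ?thesis
      using q bound0 by (intro bexI[of _ "space (hash_space m n)"]) (simp_all add: F prob_space)
  next
    case False
    let ?U = "?A \<union> ?B" and ?V = "?A \<inter> ?B"
    have fin: "finite ?U" by (simp add: supp_subset)
    have "?U \<subseteq> {..<n}" "?U \<noteq> {}" "?V \<subseteq> ?U" using supp_subset False by auto
    moreover have "\<bar>?p j\<bar> \<le> 1" if "j \<in> ?V" for j
    proof -
      have "\<bar>a j\<bar> \<le> c" "\<bar>b j\<bar> \<le> c" using that ab by (auto simp: supp_def)
      then have "\<bar>a j\<bar> * \<bar>b j\<bar> \<le> c * c" by (intro mult_mono) auto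
      then show ?thesis using c by (simp add: abs_mult abs_divide power2_eq_square)
    qed
    ultimately obtain E where E: "E \<in> events" "prob E \<ge> q" and
      err: "\<And>\<omega>. \<omega> \<in> E \<Longrightarrow> \<bar>G (\<lambda>i. winner_weight ?p ?V ?U i \<omega>) (\<lambda>i. winner_weight (\<lambda>_. 1) ?V ?U i \<omega>)
          (\<lambda>i. min_exp \<omega> ?U i) - (\<Sum>j\<in>?V. ?p j)\<bar>
          \<le> \<epsilon> * real (card ?U) * sqrt (real (card ?V) / real (card ?U) / 2)"
      using good[of ?U ?V ?p] by blast
    obtain Nl where Nl: "{\<omega> \<in> space (hash_space m n). \<not> regular \<omega>} \<subseteq> Nl" "emeasure (hash_space m n) Nl = 0" "Nl \<in> events"
      using AE_regular by (rule AE_E)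
    \<comment> \<open>Decoding is valid only on regular outcomes, so a null set containing the
      others is removed from the good event.\<close>
    have E': "E - Nl \<in> events" "prob (E - Nl) = prob E"
      using E Nl by (auto intro!: measure_Diff_null_set)
    have "\<bar>?F (minhash_sketch m n \<omega> a) (minhash_sketch m n \<omega> b) - inner_prod n a b\<bar> \<le> ?bound" if \<omega>: "\<omega> \<in> E - Nl" for \<omega>
    proof -
      have reg: "regular \<omega>" using \<omega> Nl(1) sets.sets_into_space[OF E(1)] by blast
      let ?xs = "minhash_sketch m n \<omega> a" and ?ys = "minhash_sketch m n \<omega> b"
      have A: "?A \<noteq> {}" and B: "?B \<noteq> {}" using False by auto
      note dec = sketch_decode[OF reg _ A B]
      have "G (hit_prod c ?xs ?ys) (hit ?xs ?ys) (merged_exp ?xs ?ys)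
        = G (\<lambda>i. winner_weight ?p ?V ?U i \<omega>) (\<lambda>i. winner_weight (\<lambda>_. 1) ?V ?U i \<omega>) (\<lambda>i. min_exp \<omega> ?U i)"
        by (rule cong) (simp_all add: dec)
      then have "?F ?xs ?ys - inner_prod n a b
        = c\<^sup>2 * (G (\<lambda>i. winner_weight ?p ?V ?U i \<omega>) (\<lambda>i. winner_weight (\<lambda>_. 1) ?V ?U i \<omega>) (\<lambda>i. min_exp \<omega> ?U i) - (\<Sum>j\<in>?V. ?p j))"
        unfolding inner using dec(4,5)[OF m] by (simp only: if_False right_diff_distrib simp_thms)
      then have "\<bar>?F ?xs ?ys - inner_prod n a b\<bar>
        = c\<^sup>2 * \<bar>G (\<lambda>i. winner_weight ?p ?V ?U i \<omega>) (\<lambda>i. winner_weight (\<lambda>_. 1) ?V ?U i \<omega>) (\<lambda>i. min_exp \<omega> ?U i) - (\<Sum>j\<in>?V. ?p j)\<bar>"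
        by (simp only: abs_mult abs_of_pos[OF c2])
      also have "\<dots> \<le> c\<^sup>2 * (\<epsilon> * real (card ?U) * sqrt (real (card ?V) / real (card ?U) / 2))"
        by (rule mult_left_mono[OF err]) (use \<omega> c2 in auto)
      also have "\<dots> = \<epsilon> * c\<^sup>2 * (real (card ?U) * sqrt (real (card ?V) / real (card ?U) / 2))"
        by (simp only: mult_ac)
      also have "\<dots> \<le> ?bound"
      proof (rule mult_left_mono)
        \<comment> \<open>The squared left side is \<open>card U * card V / 2\<close>, and
          \<open>card U\<close> is at most twice the larger support; the 2 inside the square root
          was put there to absorb this factor.\<close>
        have U0: "real (card ?U) > 0" using fin A by (simp add: card_gt_0_iff)
        have "card ?U \<le> card ?A + card ?B" by (rule card_Un_le)
        then have "real (card ?U) \<le> 2 * real (max (card ?A) (card ?B))" by linarith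
        then have "real (card ?U) * real (card ?V) \<le> 2 * real (max (card ?A) (card ?B)) * real (card ?V)"
          by (rule mult_right_mono) simp
        moreover have "(real (card ?U) * sqrt (real (card ?V) / real (card ?U) / 2))\<^sup>2 = real (card ?U) * real (card ?V) / 2"
          using U0 by (simp add: power_mult_distrib) (simp add: power2_eq_square)
        ultimately show "real (card ?U) * sqrt (real (card ?V) / real (card ?U) / 2)
          \<le> sqrt (real (max (card ?A) (card ?B)) * real (card ?V))"
          by (intro real_le_rsqrt) linarith
      qed (use \<epsilon> in simp)
      finally show ?thesis .
    qed
    with E E' show ?thesis by (intro bexI[of _ "E - Nl"]) auto
  qed
qed

end

section \<open>The two regimes and their constants\<close>

text \<open>The block length makes 384 / k at most \<epsilon>^2 / 2. At least one block fits, so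
  \<open>m \<le> 2 * (m div k) * k\<close>; with k \<epsilon>^2 \<le> 769 this gives m \<epsilon>^2
  \<le> 1538 g for \<open>g = m div k\<close> blocks, and the failure bound
  \<open>exp (- g / 8)\<close> is at most \<open>\<delta>\<close>.\<close>

lemma median_estimator_good:
  fixes \<epsilon> \<delta> :: real
  assumes \<epsilon>: "0 < \<epsilon>" "\<epsilon> < 1" and \<delta>: "0 < \<delta>" and m: "10 ^ 7 * ln (1 / \<delta>) / \<epsilon>\<^sup>2 \<le> real m"
    and ex: "exp_samples M m X Q Y N J s" and km: "nat \<lceil>768 / \<epsilon>\<^sup>2\<rceil> \<le> m"
  defines "k \<equiv> nat \<lceil>768 / \<epsilon>\<^sup>2\<rceil>"
  shows "\<exists>E\<in>sets M. measure M E \<ge> 1 - \<delta> \<and> (\<forall>\<omega>\<in>E.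
    \<bar>med (m div k) (\<lambda>l. (\<Sum>i\<in>{l * k..<Suc l * k}. X i \<omega>) / (\<Sum>i\<in>{l * k..<Suc l * k}. Y i \<omega>)) - s\<bar> \<le> \<epsilon> * N * sqrt (J / 2))"
proof -
  interpret exp_samples M m X Q Y N J s by fact
  have e2: "0 < \<epsilon>\<^sup>2" "\<epsilon>\<^sup>2 \<le> 1" using \<epsilon> by (simp_all add: power_le_one)
  have "768 / 1 \<le> 768 / \<epsilon>\<^sup>2" using e2 by (intro divide_left_mono) auto
  then have k0: "768 \<le> real k" "768 / \<epsilon>\<^sup>2 \<le> real k" unfolding k_def by linarith+
  have "real k \<le> 768 / \<epsilon>\<^sup>2 + 1" 
  proof -
    have "0 < 768 / \<epsilon>\<^sup>2" using e2 by simp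
    then have "real k = of_int \<lceil>768 / \<epsilon>\<^sup>2\<rceil>" unfolding k_def by (intro of_nat_nat) linarith
    then show ?thesis by linarith
  qed
  also have "\<dots> \<le> 768 / \<epsilon>\<^sup>2 + 1 / \<epsilon>\<^sup>2"
    using e2 by (intro add_left_mono) (simp only: le_divide_eq_1_pos)
  also have "\<dots> = 769 / \<epsilon>\<^sup>2" by (simp only: add_divide_distrib[symmetric]) simp
  finally have k1: "real k * \<epsilon>\<^sup>2 \<le> 769" using e2 by (simp add: field_simps)
  have k2: "768 \<le> real k * \<epsilon>\<^sup>2" using k0 e2 by (simp add: field_simps)
  let ?g = "m div k"
  have k: "32 \<le> k" "k \<le> m" using k0(1) km[folded k_def] by linarith+
  then have g: "0 < ?g" "?g * k \<le> m" by (simp_all add: div_greater_zero_iff)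
  have "m = ?g * k + m mod k" by simp
  moreover have "m mod k < k" using k by simp
  moreover have "k \<le> ?g * k" using g by simp
  ultimately have "m \<le> 2 * (?g * k)" by linarith
  then have "real m \<le> 2 * (real ?g * real k)" by (metis of_nat_le_iff of_nat_mult of_nat_numeral)
  then have "real m * \<epsilon>\<^sup>2 \<le> 2 * (real ?g * real k) * \<epsilon>\<^sup>2" using e2 by (intro mult_right_mono) auto
  also have "\<dots> = 2 * real ?g * (real k * \<epsilon>\<^sup>2)" by simp
  also have "\<dots> \<le> 2 * real ?g * 769" using k1 by (intro mult_left_mono) auto
  finally have mg: "real m * \<epsilon>\<^sup>2 \<le> 1538 * real ?g" by simp
  have "10 ^ 7 * ln (1 / \<delta>) \<le> real m * \<epsilon>\<^sup>2" using m e2 by (simp add: pos_divide_le_eq)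
  with mg have "ln (1 / \<delta>) \<le> real ?g / 8" by simp
  then have "- real ?g / 8 \<le> ln \<delta>" using \<delta> by (simp add: ln_div)
  then have "exp (- real ?g / 8) \<le> exp (ln \<delta>)" by (simp only: exp_le_cancel_iff)
  then have de: "exp (- real ?g / 8) \<le> \<delta>" using \<delta> by simp
  have "384 * N\<^sup>2 * J / real k \<le> (\<epsilon> * N * sqrt (J / 2))\<^sup>2"
  proof -
    have "384 * N\<^sup>2 * J / real k = (N\<^sup>2 * J / (2 * real k)) * 768" by simp
    also have "\<dots> \<le> (N\<^sup>2 * J / (2 * real k)) * (real k * \<epsilon>\<^sup>2)"
      using k2 J by (intro mult_left_mono) auto
    also have "\<dots> = \<epsilon>\<^sup>2 * N\<^sup>2 * (J / 2)" using k0 by simp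
    finally show ?thesis using J by (simp add: power_mult_distrib)
  qed
  then have b: "sqrt (384 * N\<^sup>2 * J / real k) \<le> \<epsilon> * N * sqrt (J / 2)"
    using \<epsilon> N_ge J by (intro real_le_lsqrt) auto
  obtain E where E: "E \<in> events" "1 - exp (- real ?g / 8) \<le> prob E"
    "\<And>\<omega>. \<omega> \<in> E \<Longrightarrow> \<bar>med ?g (\<lambda>l. ratio {l * k..<Suc l * k} \<omega>) - s\<bar> \<le> sqrt (384 * N\<^sup>2 * J / real k)"
    using median_of_ratios[OF k(1) g] by blast
  show ?thesis
  proof (intro bexI[of _ E] conjI ballI)
    show "1 - \<delta> \<le> prob E" using E(2) de by linarith
    fix \<omega> assume "\<omega> \<in> E"
    from E(3)[OF this] b show "\<bar>med ?g (\<lambda>l. (\<Sum>i\<in>{l * k..<Suc l * k}. X i \<omega>) / (\<Sum>i\<in>{l * k..<Suc l * k}. Y i \<omega>)) - s\<bar> \<le> \<epsilon> * N * sqrt (J / 2)"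
      unfolding ratio_def by linarith
  qed (rule E)
qed

text \<open>The inequality \<open>1 - \<delta> \<le> ln (1 / \<delta>)\<close> turns the lower bound
  on \<open>m\<close> into 1 - \<delta> \<le> m \<epsilon>^2 / 10^7, exactly the probability that
  \<open>dithered_ratio\<close> supplies. This is the source of the constant 10^7.\<close>

lemma dithered_estimator_good:
  fixes \<epsilon> \<delta> :: real
  assumes \<epsilon>: "0 < \<epsilon>" "\<epsilon> < 1" and \<delta>: "0 < \<delta>" and m: "10 ^ 7 * ln (1 / \<delta>) / \<epsilon>\<^sup>2 \<le> real m" "0 < m"
    and ex: "exp_samples M m X Q Y N J s" and km: "m < nat \<lceil>768 / \<epsilon>\<^sup>2\<rceil>"
  defines "K \<equiv> (if m \<le> 32 then {} else {1..<m})"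
  shows "\<exists>E\<in>sets M. measure M E \<ge> 1 - \<delta> \<and> (\<forall>\<omega>\<in>E.
    \<bar>dithered ((\<Sum>i\<in>K. X i \<omega>) / (\<Sum>i\<in>K. Y i \<omega>)) (200 * sqrt ((\<Sum>i\<in>K. Q i \<omega>) + 1) / real m) (Y 0 \<omega>) - s\<bar> \<le> \<epsilon> * N * sqrt (J / 2))"
proof -
  interpret exp_samples M m X Q Y N J s by fact
  have e2: "0 < \<epsilon>\<^sup>2" using \<epsilon> by simp
  have "real m \<le> 768 / \<epsilon>\<^sup>2" using km e2 by linarith
  then have m2: "real m * \<epsilon>\<^sup>2 \<le> 768" using e2 by (simp add: pos_le_divide_eq)
  have "10 ^ 7 * ln (1 / \<delta>) \<le> real m * \<epsilon>\<^sup>2" using m e2 by (simp add: pos_divide_le_eq)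
  moreover have "1 - \<delta> \<le> ln (1 / \<delta>)" using ln_le_minus_one[of \<delta>] \<delta> by (simp add: ln_div)
  ultimately have q: "1 - \<delta> \<le> real m * \<epsilon>\<^sup>2 / 10 ^ 7" by simp
  have "1 \<le> m" using m by simp
  from dithered_ratio[OF \<epsilon> this m2, folded K_def] obtain E where E: "E \<in> events" "real m * \<epsilon>\<^sup>2 / 10 ^ 7 \<le> prob E"
    "\<And>\<omega>. \<omega> \<in> E \<Longrightarrow> \<bar>dithered (ratio K \<omega>) (200 * sqrt ((\<Sum>i\<in>K. Q i \<omega>) + 1) / real m) (Y 0 \<omega>) - s\<bar>
      \<le> \<epsilon> * N * sqrt (J / 2)" by blast
  show ?thesis
  proof (intro bexI[of _ E] conjI ballI)
    show "1 - \<delta> \<le> prob E" using E(2) q by linarith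
  qed (use E in \<open>simp_all only: ratio_def\<close>)
qed

theorem theorem2:
  shows "\<exists>C>0. \<forall>(\<epsilon>::real) (\<delta>::real) (c::real) (m::nat) (n::nat).
    0 < \<epsilon> \<and> \<epsilon> < 1 \<and> 0 < \<delta> \<and> \<delta> < 1 \<and> 0 < c \<and>
    real m \<ge> C * ln (1 / \<delta>) / \<epsilon>\<^sup>2 \<longrightarrow>
    (\<exists>F :: (real \<times> real) list \<Rightarrow> (real \<times> real) list \<Rightarrow> real.
      \<forall>a b :: nat \<Rightarrow> real.
        (\<forall>i<n. \<bar>a i\<bar> \<le> c \<and> \<bar>b i\<bar> \<le> c) \<longrightarrow>
        (\<exists>E \<in> sets (hash_space m n).
           measure (hash_space m n) E \<ge> 1 - \<delta> \<and>
           (\<forall>\<omega> \<in> E.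
              \<bar>F (minhash_sketch m n \<omega> a) (minhash_sketch m n \<omega> b) - inner_prod n a b\<bar>
              \<le> \<epsilon> * c\<^sup>2 * sqrt (real (max (card (supp n a)) (card (supp n b)))
                                  * real (card (supp n a \<inter> supp n b))))))"
proof (rule exI[of _ "10 ^ 7 :: real"], rule conjI, simp, intro allI, rule impI, elim conjE)
  fix \<epsilon> \<delta> c :: real and m n :: nat
  assume \<epsilon>: "0 < \<epsilon>" "\<epsilon> < 1" and \<delta>: "0 < \<delta>" "\<delta> < 1" and c: "0 < c"
    and m: "10 ^ 7 * ln (1 / \<delta>) / \<epsilon>\<^sup>2 \<le> real m"
  interpret hashing m n .
  have "0 < 10 ^ 7 * ln (1 / \<delta>) / \<epsilon>\<^sup>2" using \<epsilon> \<delta> by simp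
  with m have m0: "0 < m" by (metis of_nat_0_less_iff less_le_trans)
  have q: "1 - \<delta> \<le> 1" using \<delta> by simp
  note from_samples = estimator_from_samples[OF m0 c \<epsilon>(1) q]
  show "\<exists>F :: (real \<times> real) list \<Rightarrow> (real \<times> real) list \<Rightarrow> real.
      \<forall>a b :: nat \<Rightarrow> real.
        (\<forall>i<n. \<bar>a i\<bar> \<le> c \<and> \<bar>b i\<bar> \<le> c) \<longrightarrow>
        (\<exists>E \<in> sets (hash_space m n).
           measure (hash_space m n) E \<ge> 1 - \<delta> \<and>
           (\<forall>\<omega> \<in> E.
              \<bar>F (minhash_sketch m n \<omega> a) (minhash_sketch m n \<omega> b) - inner_prod n a b\<bar>
              \<le> \<epsilon> * c\<^sup>2 * sqrt (real (max (card (supp n a)) (card (supp n b)))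
                                  * real (card (supp n a \<inter> supp n b)))))"
  \<comment> \<open>Either a full block fits and the median is used, or m \<epsilon>^2 is at most
    768 and the dithered ratio takes over.\<close>
  proof (cases "nat \<lceil>768 / \<epsilon>\<^sup>2\<rceil> \<le> m")
    case True
    define k where "k = nat \<lceil>768 / \<epsilon>\<^sup>2\<rceil>"
    let ?G = "\<lambda>X Q Y :: nat \<Rightarrow> real. med (m div k) (\<lambda>l. (\<Sum>i\<in>{l * k..<Suc l * k}. X i) / (\<Sum>i\<in>{l * k..<Suc l * k}. Y i))"
    show ?thesis
    proof (rule from_samples[of ?G])
      fix X X' Q Q' Y Y' :: "nat \<Rightarrow> real"
      assume eq: "\<And>i. i < m \<Longrightarrow> X i = X' i" "\<And>i. i < m \<Longrightarrow> Y i = Y' i"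
      show "?G X Q Y = ?G X' Q' Y'"
      proof (rule med_cong)
        fix l assume "l < m div k"
        then have "Suc l * k \<le> m div k * k" by (intro mult_right_mono) auto
        also have "\<dots> \<le> m" by simp
        finally have "i \<in> {l * k..<Suc l * k} \<Longrightarrow> i < m" for i by simp
        then show "(\<Sum>i\<in>{l * k..<Suc l * k}. X i) / (\<Sum>i\<in>{l * k..<Suc l * k}. Y i)
          = (\<Sum>i\<in>{l * k..<Suc l * k}. X' i) / (\<Sum>i\<in>{l * k..<Suc l * k}. Y' i)"
          by (intro arg_cong2[where f = "(/)"] sum.cong refl eq)
      qed
    next
      fix p U V assume "U \<subseteq> {..<n}" "U \<noteq> {}" "V \<subseteq> U" "\<And>j. j \<in> V \<Longrightarrow> \<bar>p j\<bar> \<le> (1::real)"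
      from exp_samples_hash[OF m0 this]
      show "\<exists>E\<in>events. 1 - \<delta> \<le> prob E \<and> (\<forall>\<omega>\<in>E.
        \<bar>?G (\<lambda>i. winner_weight p V U i \<omega>) (\<lambda>i. winner_weight (\<lambda>_. 1) V U i \<omega>) (\<lambda>i. min_exp \<omega> U i) - (\<Sum>j\<in>V. p j)\<bar>
          \<le> \<epsilon> * real (card U) * sqrt (real (card V) / real (card U) / 2))"
        unfolding k_def by (rule median_estimator_good[OF \<epsilon> \<delta>(1) m _ True])
    qed
  next
    case False
    let ?K = "if m \<le> 32 then {} else {1..<m}"
    let ?G = "\<lambda>X Q Y :: nat \<Rightarrow> real. dithered ((\<Sum>i\<in>?K. X i) / (\<Sum>i\<in>?K. Y i)) (200 * sqrt ((\<Sum>i\<in>?K. Q i) + 1) / real m) (Y 0)"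
    show ?thesis
    proof (rule from_samples[of ?G])
      fix X X' Q Q' Y Y' :: "nat \<Rightarrow> real"
      assume eq: "\<And>i. i < m \<Longrightarrow> X i = X' i" "\<And>i. i < m \<Longrightarrow> Q i = Q' i" "\<And>i. i < m \<Longrightarrow> Y i = Y' i"
      have "i \<in> ?K \<Longrightarrow> i < m" for i by (auto split: if_splits)
      then have "(\<Sum>i\<in>?K. X i) = (\<Sum>i\<in>?K. X' i)" "(\<Sum>i\<in>?K. Q i) = (\<Sum>i\<in>?K. Q' i)" "(\<Sum>i\<in>?K. Y i) = (\<Sum>i\<in>?K. Y' i)"
        by (intro sum.cong refl eq; blast)+
      then show "?G X Q Y = ?G X' Q' Y'" by (simp only: eq(3)[OF m0])
    next
      fix p U V assume "U \<subseteq> {..<n}" "U \<noteq> {}" "V \<subseteq> U" "\<And>j. j \<in> V \<Longrightarrow> \<bar>p j\<bar> \<le> (1::real)"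
      from exp_samples_hash[OF m0 this]
      show "\<exists>E\<in>events. 1 - \<delta> \<le> prob E \<and> (\<forall>\<omega>\<in>E.
        \<bar>?G (\<lambda>i. winner_weight p V U i \<omega>) (\<lambda>i. winner_weight (\<lambda>_. 1) V U i \<omega>) (\<lambda>i. min_exp \<omega> U i) - (\<Sum>j\<in>V. p j)\<bar>
          \<le> \<epsilon> * real (card U) * sqrt (real (card V) / real (card U) / 2))"
        by (rule dithered_estimator_good[OF \<epsilon> \<delta>(1) m m0 _ False[unfolded not_le]])
    qed
  qed
qed

end
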